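(* Let $(X_\eta)_\eta$ be a family of normed spaces, $Y_\eta\subset X_\eta^*$ subspaces and $\kappa$ an infinite cardinal. Let $P$ be one of the following properties: SD2P$_{<\kappa}$, 1-ASD2P$_{<\kappa}$ or ASD2P. The following are equivalent: (i) $(X_\eta,Y_\eta)$ satisfies $P$ for every $\eta$; (ii) $(\ell_1(X_\eta),\ell_\infty(Y_\eta))$ satisfies $P$.
   Context: Normed spaces are real and nonzero, and the family is nonempty. $B_X$, $S_X$ denote the closed unit ball and unit sphere of $X$. $\ell_1(X_\eta)$ is the $\ell_1$-sum of the family $(X_\eta)_\eta$, with dual $\ell_\infty(X_\eta^* )$ (the $\ell_\infty$-sum) acting coordinatewise, and $\ell_\infty(Y_\eta)$ is the subspace of those elements of $\ell_\infty(X_\eta^* )$ whose $\eta$-th coordinate lies in $Y_\eta$ for all $\eta$. A slice of $B_X$ defined by $x^*\in S_{X^*}$ is a set $\{x\in B_X:x^*(x)\ge1-\varepsilon\}$ with $\varepsilon\in(0,1)$. For $B\subset X$, $A\subset X^*$ and $\lambda\in(0,1)$, $B$ $\lambda$-norms $A$ if for every $x^*\in A$ there is $x\in B\setminus\{0\}$ with $x^*(x)\ge\lambda\|x^*\|\|x\|$; $B$ norms $A$ if this holds for every $\lambda\in(0,1)$. For a subspace $Y\subset X^*$: - $(X,Y)$ has the SD2P$_{<\kappa}$ if for every $A\subset S_Y$ with $|A|<\kappa$ and every $\lambda\in(0,1)$ there are $B\subset S_X$ and $x^*\in S_{X^*}$ such that $B$ $\lambda$-norms $A$ and $x^*(x)\ge\lambda$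 for every $x\in B$; - $(X,Y)$ has the 1-ASD2P$_{<\kappa}$ if for every $A\subset S_Y$ with $|A|<\kappa$ there are $B\subset S_X$ and $x^*\in S_{X^*}$ such that $B$ norms $A$ and $x^*(x)=1$ for every $x\in B$; - $(X,Y)$ has the ASD2P if every finite convex combination $\sum_{i=1}^n\lambda_iS_i$ ($\lambda_i\ge 0$, $\sum_i\lambda_i=1$) of slices $S_i$ of $B_X$ defined by functionals in $Y$ intersects $S_X$. *)

theory Defs
  imports "HOL-Analysis.Analysis" "HOL-Library.Function_Algebras"
begin

unbundle cardinal_syntax

text \<open>
  A normed space is a linear subspace \<open>X\<close> of an ambient real vector space together with a norm
  \<open>N\<close> that is only constrained on \<open>X\<close>.  A family of arbitrary (pairwise non-isomorphic) normed
  spaces is thus a family \<open>X i\<close> of subspaces of one bare vector space with unrelated norms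
  \<open>N i\<close>.  The ambient space carries no norm or topology of its own, and it is no restriction:
  every family of vector spaces embeds linearly in its direct sum.
\<close>

locale normed_space_on =
  fixes X :: "'a::real_vector set" and N :: "'a \<Rightarrow> real"
  assumes subspace: "subspace X"
    and norm_nonneg: "x \<in> X \<Longrightarrow> 0 \<le> N x"
    and norm_eq_0_iff: "x \<in> X \<Longrightarrow> N x = 0 \<longleftrightarrow> x = 0"
    and norm_scale: "x \<in> X \<Longrightarrow> N (c *\<^sub>R x) = \<bar>c\<bar> * N x"
    and norm_triangle: "x \<in> X \<Longrightarrow> y \<in> X \<Longrightarrow> N (x + y) \<le> N x + N y"

text \<open>Functions into a vector space form a vector space pointwise
  (\<^theory>\<open>HOL-Library.Function_Algebras\<close> provides the additive part).\<close>

instantiation "fun" :: (type, real_vector) real_vector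
begin

definition scaleR_fun :: "real \<Rightarrow> ('a \<Rightarrow> 'b) \<Rightarrow> 'a \<Rightarrow> 'b"
  where "scaleR_fun c f = (\<lambda>x. c *\<^sub>R f x)"

instance
  by standard (simp_all add: scaleR_fun_def fun_eq_iff algebra_simps)

end

definition unit_ball :: "'a set \<Rightarrow> ('a \<Rightarrow> real) \<Rightarrow> 'a set"
  where "unit_ball X N = {x \<in> X. N x \<le> 1}"

definition unit_sphere :: "'a set \<Rightarrow> ('a \<Rightarrow> real) \<Rightarrow> 'a set"
  where "unit_sphere X N = {x \<in> X. N x = 1}"

text \<open>
  Functionals on \<open>X\<close> are represented by their extension by \<open>0\<close> outside \<open>X\<close>.  This makes
  the representation unique, so that cardinalities of sets of functionals are the right ones, and
  makes the dual a linear subspace of the space of all real functions on the ambient type.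
\<close>

definition dual_space :: "'a::real_vector set \<Rightarrow> ('a \<Rightarrow> real) \<Rightarrow> ('a \<Rightarrow> real) set"
  where "dual_space X N =
    {f. (\<forall>x\<in>X. \<forall>y\<in>X. f (x + y) = f x + f y) \<and>
        (\<forall>c. \<forall>x\<in>X. f (c *\<^sub>R x) = c * f x) \<and>
        (\<exists>K. \<forall>x\<in>X. \<bar>f x\<bar> \<le> K * N x) \<and>
        (\<forall>x. x \<notin> X \<longrightarrow> f x = 0)}"

definition dual_norm :: "'a set \<Rightarrow> ('a \<Rightarrow> real) \<Rightarrow> ('a \<Rightarrow> real) \<Rightarrow> real"
  where "dual_norm X N f = (SUP x\<in>unit_ball X N. \<bar>f x\<bar>)"

definition l1_space :: "('i \<Rightarrow> 'a set) \<Rightarrow> ('i \<Rightarrow> 'a \<Rightarrow> real) \<Rightarrow> ('i \<Rightarrow> 'a) set"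
  where "l1_space X N = {x. (\<forall>i. x i \<in> X i) \<and> (\<lambda>i. N i (x i)) summable_on UNIV}"

definition l1_norm :: "('i \<Rightarrow> 'a \<Rightarrow> real) \<Rightarrow> ('i \<Rightarrow> 'a) \<Rightarrow> real"
  where "l1_norm N x = (\<Sum>\<^sub>\<infinity>i. N i (x i))"

text \<open>The \<open>\<ell>\<^sub>\<infinity>\<close>-sum of sets \<open>Y i\<close> of functionals on \<open>X i\<close>: first as bounded families, then
  as functionals on the \<open>\<ell>\<^sub>1\<close>-sum, on which the families act coordinatewise.\<close>

definition linf_families ::
  "('i \<Rightarrow> 'a set) \<Rightarrow> ('i \<Rightarrow> 'a \<Rightarrow> real) \<Rightarrow> ('i \<Rightarrow> ('a \<Rightarrow> real) set) \<Rightarrow> ('i \<Rightarrow> 'a \<Rightarrow> real) set"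
  where "linf_families X N Y =
    {f. (\<forall>i. f i \<in> Y i) \<and> bdd_above (range (\<lambda>i. dual_norm (X i) (N i) (f i)))}"

definition l1_action ::
  "('i \<Rightarrow> 'a set) \<Rightarrow> ('i \<Rightarrow> 'a \<Rightarrow> real) \<Rightarrow> ('i \<Rightarrow> 'a \<Rightarrow> real) \<Rightarrow> ('i \<Rightarrow> 'a) \<Rightarrow> real"
  where "l1_action X N f = (\<lambda>x. if x \<in> l1_space X N then \<Sum>\<^sub>\<infinity>i. f i (x i) else 0)"

definition linf_space ::
  "('i \<Rightarrow> 'a set) \<Rightarrow> ('i \<Rightarrow> 'a \<Rightarrow> real) \<Rightarrow> ('i \<Rightarrow> ('a \<Rightarrow> real) set) \<Rightarrow> (('i \<Rightarrow> 'a) \<Rightarrow> real) set"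
  where "linf_space X N Y = l1_action X N ` linf_families X N Y"

text \<open>The \<open>\<ell>\<^sub>1\<close>-sum is a normed space whose dual is the \<open>\<ell>\<^sub>\<infinity>\<close>-sum of the full duals, so that
  \<open>linf_space X N Y\<close> consists of the functionals on the \<open>\<ell>\<^sub>1\<close>-sum with all coordinates in \<open>Y i\<close>.\<close>

lemma l1_normed_space:
  assumes n: "\<And>i. normed_space_on (X i) (N i)"
  shows "normed_space_on (l1_space X N) (l1_norm N)"
proof -
  note sub = normed_space_on.subspace[OF n]
  note nn = normed_space_on.norm_nonneg[OF n]
  note z = normed_space_on.norm_eq_0_iff[OF n]
  note sc = normed_space_on.norm_scale[OF n]
  note tri = normed_space_on.norm_triangle[OF n]
  have S: "subspace (l1_space X N)"
  proof (rule subspaceI)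
    have "N i 0 = 0" for i using z[of 0 i] subspace_0[OF sub] by simp
    then show "0 \<in> l1_space X N"
      by (simp add: l1_space_def subspace_0[OF sub])
  next
    fix x y assume xy: "x \<in> l1_space X N" "y \<in> l1_space X N"
    then have "(\<lambda>i. N i (x i) + N i (y i)) summable_on UNIV"
      by (intro summable_on_add) (auto simp: l1_space_def)
    then have "(\<lambda>i. N i (x i + y i)) summable_on UNIV"
      by (rule summable_on_comparison_test)
         (use xy in \<open>auto simp: l1_space_def intro!: tri nn subspace_add[OF sub]\<close>)
    then show "x + y \<in> l1_space X N"
      using xy by (auto simp: l1_space_def intro!: subspace_add[OF sub])
  next
    fix c x assume x: "x \<in> l1_space X N"
    then have "(\<lambda>i. \<bar>c\<bar> * N i (x i)) summable_on UNIV"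
      by (intro summable_on_cmult_right) (auto simp: l1_space_def)
    then show "c *\<^sub>R x \<in> l1_space X N"
      using x by (auto simp: l1_space_def scaleR_fun_def sc intro!: subspace_scale[OF sub])
  qed
  show ?thesis
  proof
    show "subspace (l1_space X N)" by (rule S)
  next
    fix x assume "x \<in> l1_space X N"
    then show "0 \<le> l1_norm N x"
      unfolding l1_norm_def by (intro infsum_nonneg) (auto simp: l1_space_def nn)
  next
    fix x assume x: "x \<in> l1_space X N"
    show "l1_norm N x = 0 \<longleftrightarrow> x = 0"
    proof
      assume "l1_norm N x = 0"
      then have "N i (x i) = 0" for i
        using nonneg_infsum_le_0D[of "\<lambda>i. N i (x i)" UNIV i] x
        by (auto simp: l1_norm_def l1_space_def nn)
      then show "x = 0" using x z by (auto simp: l1_space_def fun_eq_iff)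
    next
      assume "x = 0"
      moreover have "N i 0 = 0" for i using z[of 0 i] subspace_0[OF sub] by simp
      ultimately show "l1_norm N x = 0" by (simp add: l1_norm_def)
    qed
  next
    fix x c assume x: "x \<in> l1_space X N"
    then have "l1_norm N (c *\<^sub>R x) = (\<Sum>\<^sub>\<infinity>i. \<bar>c\<bar> * N i (x i))"
      unfolding l1_norm_def by (auto simp: l1_space_def scaleR_fun_def sc intro!: infsum_cong)
    also have "\<dots> = \<bar>c\<bar> * l1_norm N x"
      unfolding l1_norm_def by (rule infsum_cmult_right) (use x in \<open>auto simp: l1_space_def\<close>)
    finally show "l1_norm N (c *\<^sub>R x) = \<bar>c\<bar> * l1_norm N x" .
  next
    fix x y assume xy: "x \<in> l1_space X N" "y \<in> l1_space X N"
    then have "x + y \<in> l1_space X N" by (rule subspace_add[OF S])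
    then have "l1_norm N (x + y) \<le> (\<Sum>\<^sub>\<infinity>i. N i (x i) + N i (y i))"
      unfolding l1_norm_def using xy
      by (intro infsum_mono summable_on_add) (auto simp: l1_space_def tri)
    also have "\<dots> = l1_norm N x + l1_norm N y"
      unfolding l1_norm_def using xy by (intro infsum_add) (auto simp: l1_space_def)
    finally show "l1_norm N (x + y) \<le> l1_norm N x + l1_norm N y" .
  qed
qed

lemma dual_bound:
  assumes n: "normed_space_on X N" and f: "f \<in> dual_space X N" and x: "x \<in> X"
  shows "\<bar>f x\<bar> \<le> dual_norm X N f * N x"
proof (cases "x = 0")
  case True
  have "f (0 *\<^sub>R x) = 0 * f x" using f x unfolding dual_space_def by blast
  then show ?thesis using True normed_space_on.norm_eq_0_iff[OF n x] by simp
next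
  case False
  have pos: "N x > 0"
    using False normed_space_on.norm_eq_0_iff[OF n x] normed_space_on.norm_nonneg[OF n x] by simp
  obtain K where K: "\<And>x. x \<in> X \<Longrightarrow> \<bar>f x\<bar> \<le> K * N x" using f unfolding dual_space_def by blast
  have "bdd_above ((\<lambda>x. \<bar>f x\<bar>) ` unit_ball X N)"
  proof (rule bdd_aboveI2)
    fix y assume y: "y \<in> unit_ball X N"
    then have "\<bar>f y\<bar> \<le> K * N y" using K by (simp add: unit_ball_def)
    also have "\<dots> \<le> \<bar>K\<bar> * 1"
      using y normed_space_on.norm_nonneg[OF n] by (intro mult_mono) (auto simp: unit_ball_def)
    finally show "\<bar>f y\<bar> \<le> \<bar>K\<bar>" by simp
  qed
  moreover have "(1 / N x) *\<^sub>R x \<in> unit_ball X N"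
    using x pos normed_space_on.norm_scale[OF n x, of "1 / N x"]
    by (auto simp: unit_ball_def intro!: subspace_scale[OF normed_space_on.subspace[OF n]])
  ultimately have "\<bar>f ((1 / N x) *\<^sub>R x)\<bar> \<le> dual_norm X N f"
    unfolding dual_norm_def by (rule cSUP_upper[rotated])
  moreover have "f ((1 / N x) *\<^sub>R x) = (1 / N x) * f x"
    using f x by (auto simp: dual_space_def)
  ultimately show ?thesis using pos by (simp add: abs_mult field_simps)
qed

lemma dual_norm_le:
  assumes n: "normed_space_on X N" and "\<And>x. x \<in> X \<Longrightarrow> \<bar>f x\<bar> \<le> K * N x" "K \<ge> 0"
  shows "dual_norm X N f \<le> K"
  unfolding dual_norm_def
proof (rule cSUP_least)
  have "0 \<in> X" using normed_space_on.subspace[OF n] by (rule subspace_0)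
  then have "0 \<in> unit_ball X N" using normed_space_on.norm_eq_0_iff[OF n, of 0] by (simp add: unit_ball_def)
  then show "unit_ball X N \<noteq> {}" by blast
  fix x assume x: "x \<in> unit_ball X N"
  have "\<bar>f x\<bar> \<le> K * N x" using assms x by (simp add: unit_ball_def)
  also have "\<dots> \<le> K * 1" using x assms(3) by (intro mult_left_mono) (auto simp: unit_ball_def)
  finally show "\<bar>f x\<bar> \<le> K" by simp
qed

lemma dual_l1:
  assumes n: "\<And>i. normed_space_on (X i) (N i)"
  shows "dual_space (l1_space X N) (l1_norm N) = linf_space X N (\<lambda>i. dual_space (X i) (N i))"
proof (intro equalityI subsetI)
  note sub = normed_space_on.subspace[OF n]
  note nn = normed_space_on.norm_nonneg[OF n]
  note z = normed_space_on.norm_eq_0_iff[OF n]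
  note L = l1_normed_space[of X N, OF n]
  fix F assume F: "F \<in> linf_space X N (\<lambda>i. dual_space (X i) (N i))"
  then obtain f where f: "f i \<in> dual_space (X i) (N i)" and
    bd: "bdd_above (range (\<lambda>i. dual_norm (X i) (N i) (f i)))" and FF: "F = l1_action X N f" for i
    by (auto simp: linf_space_def linf_families_def)
  obtain K where K: "\<And>i. dual_norm (X i) (N i) (f i) \<le> K" using bd by (auto simp: bdd_above_def)
  have b: "\<bar>f i u\<bar> \<le> K * N i u" if "u \<in> X i" for i u
    using dual_bound[OF n f that] K[of i] nn[OF that] by (meson mult_right_mono order_trans)
  have sK: "(\<lambda>i. K * N i (x i)) summable_on UNIV" if "x \<in> l1_space X N" for x
    using that by (intro summable_on_cmult_right) (auto simp: l1_space_def)
  have sab: "(\<lambda>i. \<bar>f i (x i)\<bar>) summable_on UNIV" if "x \<in> l1_space X N" for x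
    using sK[OF that] by (rule summable_on_comparison_test) (use that b in \<open>auto simp: l1_space_def\<close>)
  have s: "(\<lambda>i. f i (x i)) summable_on UNIV" if "x \<in> l1_space X N" for x
    by (rule summable_on_iff_abs_summable_on_real[THEN iffD2]) (use sab[OF that] in simp)
  note SL = normed_space_on.subspace[OF L]
  show "F \<in> dual_space (l1_space X N) (l1_norm N)"
    unfolding dual_space_def
  proof (safe, goal_cases)
    case (1 x y)
    have "(\<Sum>\<^sub>\<infinity>i. f i (x i + y i)) = (\<Sum>\<^sub>\<infinity>i. f i (x i) + f i (y i))"
      using 1 f by (intro infsum_cong) (auto simp: l1_space_def dual_space_def)
    also have "\<dots> = (\<Sum>\<^sub>\<infinity>i. f i (x i)) + (\<Sum>\<^sub>\<infinity>i. f i (y i))" by (intro infsum_add s 1)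
    finally show ?case using 1 by (simp add: FF l1_action_def subspace_add[OF SL])
  next
    case (2 c x)
    have "(\<Sum>\<^sub>\<infinity>i. f i (c *\<^sub>R x i)) = (\<Sum>\<^sub>\<infinity>i. c * f i (x i))"
      using 2 f by (intro infsum_cong) (auto simp: l1_space_def dual_space_def)
    also have "\<dots> = c * (\<Sum>\<^sub>\<infinity>i. f i (x i))" by (intro infsum_cmult_right s 2)
    finally show ?case using 2 subspace_scale[OF SL, of x c]
      by (simp add: FF l1_action_def) (simp add: scaleR_fun_def)
  next
    case 3
    have "\<bar>F x\<bar> \<le> K * l1_norm N x" if x: "x \<in> l1_space X N" for x
    proof -
      have "\<bar>F x\<bar> \<le> (\<Sum>\<^sub>\<infinity>i. \<bar>f i (x i)\<bar>)"
        using x sab[OF x] norm_infsum_bound[of "\<lambda>i. f i (x i)" UNIV] by (simp add: FF l1_action_def)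
      also have "\<dots> \<le> (\<Sum>\<^sub>\<infinity>i. K * N i (x i))"
        by (intro infsum_mono sab sK x) (use x b in \<open>auto simp: l1_space_def\<close>)
      also have "\<dots> = K * l1_norm N x"
        unfolding l1_norm_def by (rule infsum_cmult_right) (use x in \<open>auto simp: l1_space_def\<close>)
      finally show ?thesis .
    qed
    then show ?case by blast
  next
    case (4 x)
    then show ?case by (simp add: FF l1_action_def)
  qed
next
  note sub = normed_space_on.subspace[OF n]
  note nn = normed_space_on.norm_nonneg[OF n]
  note z = normed_space_on.norm_eq_0_iff[OF n]
  note L = l1_normed_space[of X N, OF n]
  note SL = normed_space_on.subspace[OF L]
  have z0: "N i 0 = 0" for i using z[of 0 i] subspace_0[OF sub] by simp
  fix F assume F: "F \<in> dual_space (l1_space X N) (l1_norm N)"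
  define e where "e i u = (\<lambda>j. if j = i then u else 0)" for i :: 'a and u :: 'b
  have eN: "((\<lambda>j. N j (e i u j)) has_sum N i u) UNIV" for i u
    by (rule has_sum_finite_neutralI[of "{i}"])
       (auto simp: e_def z0)
  have e: "e i u \<in> l1_space X N" "l1_norm N (e i u) = N i u" if "u \<in> X i" for i u
    using eN[of i u] that subspace_0[OF sub]
    by (auto simp: l1_space_def l1_norm_def summable_on_def e_def infsumI)
  define D where "D = dual_norm (l1_space X N) (l1_norm N) F"
  have Fb: "\<bar>F x\<bar> \<le> D * l1_norm N x" if "x \<in> l1_space X N" for x
    unfolding D_def by (rule dual_bound[OF L F that])
  have Fadd: "F (x + y) = F x + F y" if "x \<in> l1_space X N" "y \<in> l1_space X N" for x y
    using F that by (auto simp: dual_space_def)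
  have Fsc: "F (c *\<^sub>R x) = c * F x" if "x \<in> l1_space X N" for x c
    using F that by (auto simp: dual_space_def)
  define f where "f i u = (if u \<in> X i then F (e i u) else 0)" for i u
  have fd: "f i \<in> dual_space (X i) (N i)" for i
    unfolding dual_space_def
  proof (safe, goal_cases)
    case (1 x y)
    have "e i (x + y) = e i x + e i y" by (auto simp: e_def)
    then show ?case using 1 by (simp add: f_def subspace_add[OF sub] Fadd e)
  next
    case (2 c x)
    have "e i (c *\<^sub>R x) = c *\<^sub>R e i x" by (auto simp: e_def scaleR_fun_def)
    then show ?case using 2 by (simp add: f_def subspace_scale[OF sub] Fsc e)
  next
    case 3
    show ?case using Fb e by (intro exI[of _ D]) (simp add: f_def, metis)
  next
    case (4 x) then show ?case by (simp add: f_def)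
  qed
  have "dual_norm (X i) (N i) (f i) \<le> \<bar>D\<bar>" for i
  proof (rule dual_norm_le[OF n])
    fix x assume x: "x \<in> X i"
    then have "\<bar>f i x\<bar> \<le> D * N i x" using Fb[OF e(1)] e(2) by (simp add: f_def)
    also have "\<dots> \<le> \<bar>D\<bar> * N i x" using nn[OF x] by (intro mult_right_mono) auto
    finally show "\<bar>f i x\<bar> \<le> \<bar>D\<bar> * N i x" .
  qed simp
  then have mem: "f \<in> linf_families X N (\<lambda>i. dual_space (X i) (N i))"
    using fd by (auto simp: linf_families_def intro!: bdd_aboveI2)
  have "F x = l1_action X N f x" for x
  proof (cases "x \<in> l1_space X N")
    case False then show ?thesis using F by (simp add: dual_space_def l1_action_def)
  next
    case x: True
    then have xi: "x i \<in> X i" for i by (simp add: l1_space_def)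
    define r where "r S = (\<lambda>j. if j \<in> S then x j else 0)" for S
    have rin: "r S \<in> l1_space X N" for S
    proof -
      have "(\<lambda>j. N j (r S j)) summable_on UNIV"
        by (rule summable_on_comparison_test[of "\<lambda>j. N j (x j)"])
           (use x in \<open>auto simp: l1_space_def r_def z0 nn\<close>)
      then show ?thesis using xi by (auto simp: l1_space_def r_def subspace_0[OF sub])
    qed
    have Fr: "F (r S) = (\<Sum>i\<in>S. f i (x i))" if "finite S" for S
      using that
    proof (induction S)
      case empty
      have "F (0 *\<^sub>R x) = 0" using Fsc[OF x, of 0] by simp
      then show ?case by (simp add: r_def zero_fun_def)
    next
      case (insert i S)
      have "r (insert i S) = e i (x i) + r S" using insert by (auto simp: r_def e_def fun_eq_iff)
      then have "F (r (insert i S)) = F (e i (x i)) + F (r S)" using Fadd[OF e(1)[OF xi] rin] by metis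
      then show ?case using insert xi by (simp add: f_def)
    qed
    have tl: "\<bar>F x - F (r S)\<bar> \<le> D * (l1_norm N x - (\<Sum>i\<in>S. N i (x i)))" if S: "finite S" for S
    proof -
      have eq: "x = r S + r (- S)" by (auto simp: r_def fun_eq_iff)
      then have "F x = F (r S) + F (r (- S))" using Fadd[OF rin rin] by metis
      then have "\<bar>F x - F (r S)\<bar> \<le> D * l1_norm N (r (-S))" using Fb[OF rin] by simp
      also have "l1_norm N (r (- S)) = (\<Sum>\<^sub>\<infinity>i\<in>-S. N i (x i))"
        unfolding l1_norm_def by (rule infsum_cong_neutral) (auto simp: r_def z0)
      also have "\<dots> = l1_norm N x - (\<Sum>i\<in>S. N i (x i))"
        using infsum_Diff[of "\<lambda>i. N i (x i)" UNIV S] x S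
        by (simp add: l1_space_def l1_norm_def Compl_eq_Diff_UNIV)
      finally show ?thesis .
    qed
    have "((\<lambda>i. N i (x i)) has_sum l1_norm N x) UNIV"
      using x by (simp add: l1_space_def l1_norm_def)
    then have "((\<lambda>S. D * (l1_norm N x - (\<Sum>i\<in>S. N i (x i)))) \<longlongrightarrow> D * (l1_norm N x - l1_norm N x))
        (finite_subsets_at_top UNIV)"
      unfolding has_sum_def by (intro tendsto_intros)
    then have lim: "((\<lambda>S. D * (l1_norm N x - (\<Sum>i\<in>S. N i (x i)))) \<longlongrightarrow> 0) (finite_subsets_at_top UNIV)"
      by simp
    have "\<forall>\<^sub>F S in finite_subsets_at_top UNIV. norm (F x - F (r S)) \<le> D * (l1_norm N x - (\<Sum>i\<in>S. N i (x i)))"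
      by (rule eventually_finite_subsets_at_top_weakI) (use tl in simp)
    from Lim_null_comparison[OF this lim]
    have "((\<lambda>S. F x - (F x - F (r S))) \<longlongrightarrow> F x - 0) (finite_subsets_at_top UNIV)"
      by (intro tendsto_diff tendsto_const)
    then have "((\<lambda>S. F (r S)) \<longlongrightarrow> F x) (finite_subsets_at_top UNIV)" by simp
    then have "((\<lambda>i. f i (x i)) has_sum F x) UNIV"
      unfolding has_sum_def
      by (rule Lim_transform_eventually)
         (rule eventually_finite_subsets_at_top_weakI, rule Fr)
    then show ?thesis using x by (simp add: l1_action_def infsumI)
  qed
  then have "F = l1_action X N f" ..
  then show "F \<in> linf_space X N (\<lambda>i. dual_space (X i) (N i))" using mem by (simp add: linf_space_def)
qed

definition slice :: "'a set \<Rightarrow> ('a \<Rightarrow> real) \<Rightarrow> ('a \<Rightarrow> real) \<Rightarrow> real \<Rightarrow> 'a set"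
  where "slice X N f \<epsilon> = {x \<in> unit_ball X N. f x \<ge> 1 - \<epsilon>}"

definition lam_norms ::
  "'a::real_vector set \<Rightarrow> ('a \<Rightarrow> real) \<Rightarrow> real \<Rightarrow> 'a set \<Rightarrow> ('a \<Rightarrow> real) set \<Rightarrow> bool"
  where "lam_norms X N t B A \<longleftrightarrow>
    (\<forall>f\<in>A. \<exists>x\<in>B - {0}. f x \<ge> t * dual_norm X N f * N x)"

definition norms ::
  "'a::real_vector set \<Rightarrow> ('a \<Rightarrow> real) \<Rightarrow> 'a set \<Rightarrow> ('a \<Rightarrow> real) set \<Rightarrow> bool"
  where "norms X N B A \<longleftrightarrow> (\<forall>t. 0 < t \<and> t < 1 \<longrightarrow> lam_norms X N t B A)"

definition SD2P_less ::
  "'k rel \<Rightarrow> 'a::real_vector set \<Rightarrow> ('a \<Rightarrow> real) \<Rightarrow> ('a \<Rightarrow> real) set \<Rightarrow> bool"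
  where "SD2P_less \<kappa> X N Y \<longleftrightarrow>
    (\<forall>A t. A \<subseteq> unit_sphere Y (dual_norm X N) \<and> |A| <o \<kappa> \<and> 0 < t \<and> t < 1 \<longrightarrow>
      (\<exists>B f. B \<subseteq> unit_sphere X N \<and> f \<in> unit_sphere (dual_space X N) (dual_norm X N) \<and>
        lam_norms X N t B A \<and> (\<forall>x\<in>B. f x \<ge> t)))"

definition one_ASD2P_less ::
  "'k rel \<Rightarrow> 'a::real_vector set \<Rightarrow> ('a \<Rightarrow> real) \<Rightarrow> ('a \<Rightarrow> real) set \<Rightarrow> bool"
  where "one_ASD2P_less \<kappa> X N Y \<longleftrightarrow>
    (\<forall>A. A \<subseteq> unit_sphere Y (dual_norm X N) \<and> |A| <o \<kappa> \<longrightarrow>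
      (\<exists>B f. B \<subseteq> unit_sphere X N \<and> f \<in> unit_sphere (dual_space X N) (dual_norm X N) \<and>
        norms X N B A \<and> (\<forall>x\<in>B. f x = 1)))"

definition ASD2P :: "'a::real_vector set \<Rightarrow> ('a \<Rightarrow> real) \<Rightarrow> ('a \<Rightarrow> real) set \<Rightarrow> bool"
  where "ASD2P X N Y \<longleftrightarrow>
    (\<forall>(n::nat) w S.
      (\<forall>i<n. 0 \<le> w i) \<and> (\<Sum>i<n. w i) = 1 \<and>
      (\<forall>i<n. \<exists>f \<epsilon>. f \<in> unit_sphere Y (dual_norm X N) \<and> 0 < \<epsilon> \<and> \<epsilon> < 1 \<and> S i = slice X N f \<epsilon>) \<longrightarrow>
      {\<Sum>i<n. w i *\<^sub>R s i | s. \<forall>i<n. s i \<in> S i} \<inter> unit_sphere X N \<noteq> {})"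

end

theory Submission
  imports Defs
begin

text \<open>
  In an \<open>\<ell>\<^sub>1\<close>-sum the norm splits as \<open>\<parallel>x\<parallel> = \<parallel>x\<^sub>i\<parallel> + \<parallel>rest\<parallel>\<close>, while a functional of norm one is a
  family of functionals whose norms have supremum one.  All six implications come from moving vectors
  and functionals between one coordinate and the sum along these two facts.

  From the coordinates to the sum.  A functional of norm one has a coordinate of norm almost one, so a
  vector of \<open>X\<^sub>i\<close> that norms the normalised coordinate almost norms the functional
  (\<open>lam_norms_glue\<close>).  Hence sets that norm the normalised coordinates, put into the sum
  and united, norm the given set, and the family of the dual functionals has norm one and the
  required lower bound on them.  For the same reason a slice of the ball of the sum contains a copy
  of a slice of the ball of one coordinate; norms of vectors in different coordinates add up, so
  combinations of norm equal to their weight in each coordinate give a combination of norm one.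

  From the sum to a coordinate.  Lift functionals on \<open>X\<^sub>i\<close> by \<open>0\<close>.  If a unit vector \<open>x\<close> almost norms
  a lifted functional, then \<open>\<parallel>x\<^sub>i\<parallel>\<close> is almost one and the other coordinates hardly contribute to any
  functional in the ball; so \<open>x\<^sub>i / \<parallel>x\<^sub>i\<parallel>\<close> and the \<open>i\<close>-th coordinate of the dual functional do the job
  (\<open>lam_norms_proj\<close>, \<open>proj_functional_lower\<close>).  If the dual functional is exactly one at \<open>x\<close>, then its
  normalised coordinate is exactly one at \<open>x\<^sub>i / \<parallel>x\<^sub>i\<parallel>\<close>.
  For slices, a combination of norm one has no cancellation in the coordinate \<open>i\<close>, and absence of
  cancellation is stable under positive rescaling of the vectors (\<open>norm_sum_reweight\<close>).

  The empty set of functionals hides a further demand: SD2P and 1-ASD2P then only assert that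
  the dual sphere is nonempty.  In the sum this says nothing about a prescribed coordinate, so it has to be
  derived from the Hahn--Banach theorem (\<open>ex_dual_norm_1\<close>).
\<close>

section \<open>Existence of functionals of norm one\<close>

context normed_space_on
begin

text \<open>Sublinear functionals are extended by \<open>0\<close> outside \<open>X\<close>, as functionals are; the pointwise
  order on \<open>X\<close> is then the order of functions, and antisymmetric.  Homogeneity is demanded as an
  inequality only, since applying it to \<open>c\<close> and \<open>1 / c\<close> gives equality.\<close>

definition sublinear :: "('a \<Rightarrow> real) \<Rightarrow> bool" where
  "sublinear p \<longleftrightarrow> (\<forall>x\<in>X. \<forall>y\<in>X. p (x + y) \<le> p x + p y) \<and>
    (\<forall>c>0. \<forall>x\<in>X. p (c *\<^sub>R x) \<le> c * p x) \<and> (\<forall>x. x \<notin> X \<longrightarrow> p x = 0)"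

lemma sublinear_add: "sublinear p \<Longrightarrow> x \<in> X \<Longrightarrow> y \<in> X \<Longrightarrow> p (x + y) \<le> p x + p y"
  by (simp add: sublinear_def)

lemma sublinear_scale_le: "sublinear p \<Longrightarrow> x \<in> X \<Longrightarrow> c > 0 \<Longrightarrow> p (c *\<^sub>R x) \<le> c * p x"
  by (simp add: sublinear_def)

lemma scale_mem: "x \<in> X \<Longrightarrow> c *\<^sub>R x \<in> X"
  and add_mem: "x \<in> X \<Longrightarrow> y \<in> X \<Longrightarrow> x + y \<in> X"
  and neg_mem: "x \<in> X \<Longrightarrow> - x \<in> X"
  and zero_mem: "0 \<in> X"
  using subspace by (auto intro: subspace_scale subspace_add subspace_neg subspace_0)

lemma norm_zero: "N 0 = 0"
  using norm_eq_0_iff[OF zero_mem] by simp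

lemma norm_pos: "x \<in> X \<Longrightarrow> x \<noteq> 0 \<Longrightarrow> N x > 0"
  using norm_nonneg[of x] norm_eq_0_iff[of x] by simp

lemma sublinear_scale:
  assumes p: "sublinear p" and x: "x \<in> X" and c: "c > 0"
  shows "p (c *\<^sub>R x) = c * p x"
proof (rule antisym)
  show "p (c *\<^sub>R x) \<le> c * p x" by (rule sublinear_scale_le[OF p x c])
  have "p ((1 / c) *\<^sub>R (c *\<^sub>R x)) \<le> (1 / c) * p (c *\<^sub>R x)"
    by (rule sublinear_scale_le[OF p]) (use x c in \<open>auto intro: scale_mem\<close>)
  then show "c * p x \<le> p (c *\<^sub>R x)" using c by (simp add: field_simps)
qed

lemma sublinear_zero: "sublinear p \<Longrightarrow> p 0 = 0"
  using sublinear_scale[OF _ zero_mem, of p 2] by simp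

lemma sublinear_lower: "sublinear p \<Longrightarrow> x \<in> X \<Longrightarrow> - p (- x) \<le> p x"
  using sublinear_add[of p x "- x"] sublinear_zero[of p] neg_mem by simp

text \<open>Every sublinear functional \<open>p\<close> dominates a sublinear functional that is linear along the line
  through a prescribed \<open>y\<close>, because it is at most \<open>- p y\<close> at \<open>- y\<close>.  Applied to the norm this
  prescribes the value at one point, and applied to a minimal \<open>p\<close> it forces additivity.\<close>

lemma sublinear_descent:
  assumes p: "sublinear p" and y: "y \<in> X"
  obtains q where "sublinear q" "q \<le> p" "\<And>x t. x \<in> X \<Longrightarrow> t \<ge> 0 \<Longrightarrow> q x \<le> p (x + t *\<^sub>R y) - t * p y"
proof -
  define h where "h x t = p (x + t *\<^sub>R y) - t * p y" for x and t :: real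
  define q where "q x = (if x \<in> X then INF t\<in>{0..}. h x t else 0)" for x
  have lower: "- p (- x) \<le> h x t" if "x \<in> X" "t \<ge> 0" for x t
  proof (cases "t = 0")
    case True
    then show ?thesis using sublinear_lower[OF p that(1)] by (simp add: h_def)
  next
    case False
    then have "t * p y = p ((x + t *\<^sub>R y) + - x)" using sublinear_scale[OF p y, of t] that by simp
    also have "\<dots> \<le> p (x + t *\<^sub>R y) + p (- x)"
      by (intro sublinear_add p add_mem scale_mem neg_mem that y)
    finally show ?thesis by (simp add: h_def)
  qed
  have q_le: "q x \<le> h x t" if "x \<in> X" "t \<ge> 0" for x t
    unfolding q_def using that by (auto intro!: cINF_lower bdd_belowI2 lower)
  have q_ge: "c \<le> q x" if "x \<in> X" "\<And>t. t \<ge> 0 \<Longrightarrow> c \<le> h x t" for x c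
    unfolding q_def using that by (auto intro!: cINF_greatest)
  have sub: "q (x + x') \<le> q x + q x'" if x: "x \<in> X" "x' \<in> X" for x x'
  proof -
    have *: "q (x + x') \<le> h x t + h x' s" if "t \<ge> 0" "s \<ge> 0" for s t
    proof -
      have "q (x + x') \<le> h (x + x') (t + s)" using that x by (intro q_le add_mem) auto
      also have "\<dots> = p ((x + t *\<^sub>R y) + (x' + s *\<^sub>R y)) - (t + s) * p y"
        by (simp add: h_def algebra_simps)
      also have "\<dots> \<le> h x t + h x' s"
        using sublinear_add[OF p, of "x + t *\<^sub>R y" "x' + s *\<^sub>R y"] x y
        by (simp add: h_def algebra_simps add_mem scale_mem)
      finally show ?thesis .
    qed
    have "q (x + x') - h x t \<le> q x'" if "t \<ge> 0" for t
      by (rule q_ge[OF x(2)]) (use *[OF that] in \<open>simp add: algebra_simps\<close>)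
    then have "q (x + x') - q x' \<le> q x" by (intro q_ge[OF x(1)]) (simp add: algebra_simps)
    then show ?thesis by simp
  qed
  have hom: "q (c *\<^sub>R x) \<le> c * q x" if x: "x \<in> X" and c: "c > 0" for x c
  proof -
    have "q (c *\<^sub>R x) / c \<le> h x t" if "t \<ge> 0" for t
    proof -
      have "q (c *\<^sub>R x) \<le> h (c *\<^sub>R x) (c * t)" by (rule q_le) (use x c that in \<open>auto intro: scale_mem\<close>)
      also have "\<dots> = p (c *\<^sub>R (x + t *\<^sub>R y)) - c * t * p y" by (simp add: h_def algebra_simps)
      also have "\<dots> = c * h x t"
        using sublinear_scale[OF p _ c, of "x + t *\<^sub>R y"] x y
        by (simp add: h_def algebra_simps add_mem scale_mem)
      finally show ?thesis using c by (simp add: field_simps)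
    qed
    then have "q (c *\<^sub>R x) / c \<le> q x" by (rule q_ge[OF x])
    then show ?thesis using c by (simp add: field_simps)
  qed
  show thesis
  proof (rule that[of q])
    show "sublinear q" using sub hom by (simp add: sublinear_def q_def)
    have "q x \<le> p x" for x
      using q_le[of x 0] p by (cases "x \<in> X") (auto simp: h_def q_def sublinear_def)
    then show "q \<le> p" by (simp add: le_fun_def)
  qed (use q_le in \<open>simp add: h_def\<close>)
qed

text \<open>Zorn's lemma applies below a given sublinear functional \<open>p\<close>: along a chain the values at \<open>x\<close> are
  bounded below by \<open>- p (- x)\<close>, and the pointwise infimum of a chain is sublinear.\<close>

lemma ex_minimal_sublinear:
  assumes p: "sublinear p"
  obtains m where "sublinear m" "m \<le> p" "\<And>q. sublinear q \<Longrightarrow> q \<le> m \<Longrightarrow> q = m"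
proof -
  define \<Q> where "\<Q> = {q. sublinear q \<and> q \<le> p}"
  have "\<exists>u\<in>\<Q>. \<forall>a\<in>C. u \<le> a" if C: "C \<in> Chains (relation_of (\<lambda>a b. b \<le> a) \<Q>)" for C
  proof (cases "C = {}")
    case True
    then show ?thesis using p by (auto simp: \<Q>_def)
  next
    case False
    have mem: "sublinear a" "a \<le> p" if "a \<in> C" for a
      using C that by (auto simp: Chains_def relation_of_def \<Q>_def)
    have tot: "a \<le> b \<or> b \<le> a" if "a \<in> C" "b \<in> C" for a b
      using C that by (auto simp: Chains_def relation_of_def)
    define u where "u x = (INF a\<in>C. a x)" for x
    have u_le: "u x \<le> a x" if "a \<in> C" for a x
    proof -
      have "bdd_below ((\<lambda>a. a x) ` C)"
      proof (rule bdd_belowI2)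
        fix b assume b: "b \<in> C"
        show "min 0 (- p (- x)) \<le> b x"
        proof (cases "x \<in> X")
          case True
          have "b (- x) \<le> p (- x)" using mem(2)[OF b] by (simp add: le_fun_def)
          then show ?thesis using sublinear_lower[OF mem(1)[OF b] True] by simp
        next
          case False
          then show ?thesis using mem(1)[OF b] by (simp add: sublinear_def)
        qed
      qed
      then show ?thesis unfolding u_def by (rule cINF_lower) (rule that)
    qed
    have u_ge: "c \<le> u x" if "\<And>a. a \<in> C \<Longrightarrow> c \<le> a x" for c x
      unfolding u_def using False that by (rule cINF_greatest)
    have "u (x + y) \<le> u x + u y" if xy: "x \<in> X" "y \<in> X" for x y
    proof -
      have *: "u (x + y) \<le> a x + b y" if ab: "a \<in> C" "b \<in> C" for a b
      proof -
        obtain d where d: "d \<in> C" "d \<le> a" "d \<le> b" using tot[OF ab] ab by auto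
        have "u (x + y) \<le> d (x + y)" by (rule u_le[OF d(1)])
        also have "\<dots> \<le> d x + d y" by (rule sublinear_add[OF mem(1)[OF d(1)] xy])
        also have "\<dots> \<le> a x + b y" using d by (intro add_mono) (auto simp: le_fun_def)
        finally show ?thesis .
      qed
      have "u (x + y) - a x \<le> u y" if "a \<in> C" for a
        by (rule u_ge) (use *[OF that] in \<open>simp add: algebra_simps\<close>)
      then have "u (x + y) - u y \<le> u x" by (intro u_ge) (simp add: algebra_simps)
      then show ?thesis by simp
    qed
    moreover have "u (c *\<^sub>R x) \<le> c * u x" if x: "x \<in> X" and c: "c > 0" for c x
    proof -
      have "u (c *\<^sub>R x) / c \<le> a x" if "a \<in> C" for a
        using u_le[OF that, of "c *\<^sub>R x"] sublinear_scale[OF mem(1)[OF that] x c] c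
        by (simp add: field_simps)
      then have "u (c *\<^sub>R x) / c \<le> u x" by (rule u_ge)
      then show ?thesis using c by (simp add: field_simps)
    qed
    moreover have "u x = 0" if "x \<notin> X" for x
    proof -
      have "a x = 0" if "a \<in> C" for a using mem(1)[OF that] \<open>x \<notin> X\<close> by (simp add: sublinear_def)
      then have "(\<lambda>a. a x) ` C = {0}" using False by force
      then show ?thesis by (simp add: u_def)
    qed
    ultimately have "sublinear u" by (simp add: sublinear_def)
    moreover obtain a where a: "a \<in> C" using False by auto
    have "u \<le> p" using u_le[OF a] mem(2)[OF a] by (auto simp: le_fun_def intro: order_trans)
    ultimately show ?thesis using u_le by (auto simp: \<Q>_def le_fun_def)
  qed
  moreover have "partial_order_on \<Q> (relation_of (\<lambda>a b. b \<le> a) \<Q>)"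
    by (rule partial_order_on_relation_ofI) auto
  ultimately obtain m where m: "m \<in> \<Q>" "\<And>a. a \<in> \<Q> \<Longrightarrow> a \<le> m \<Longrightarrow> a = m"
    using predicate_Zorn[of \<Q> "\<lambda>a b. b \<le> a"] by auto
  show thesis by (rule that[of m]) (use m in \<open>auto simp: \<Q>_def intro: order_trans\<close>)
qed

lemma additive_if_minimal_sublinear:
  assumes m: "sublinear m" and min: "\<And>q. sublinear q \<Longrightarrow> q \<le> m \<Longrightarrow> q = m"
    and x: "x \<in> X" and y: "y \<in> X"
  shows "m (x + y) = m x + m y"
proof (rule antisym)
  show "m (x + y) \<le> m x + m y" by (rule sublinear_add[OF m x y])
  obtain q where q: "sublinear q" "q \<le> m"
    and qt: "\<And>x t. x \<in> X \<Longrightarrow> t \<ge> 0 \<Longrightarrow> q x \<le> m (x + t *\<^sub>R y) - t * m y"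
    using sublinear_descent[OF m y] by metis
  show "m x + m y \<le> m (x + y)" using qt[OF x, of 1] min[OF q] by simp
qed

text \<open>The Hahn--Banach theorem for a line: descend from the norm so that the value at \<open>- x\<^sub>0\<close> is at
  most \<open>- N x\<^sub>0\<close>, and pass to a minimal sublinear functional below, which is linear.\<close>

lemma ex_dual_norm_1:
  assumes "X \<noteq> {0}"
  shows "\<exists>f. f \<in> unit_sphere (dual_space X N) (dual_norm X N)"
proof -
  obtain x0 where x0: "x0 \<in> X" "x0 \<noteq> 0" using assms zero_mem by blast
  define p where "p x = (if x \<in> X then N x else 0)" for x
  have p: "sublinear p" by (auto simp: sublinear_def p_def norm_triangle norm_scale add_mem scale_mem)
  obtain q where q: "sublinear q" "q \<le> p"
    and qt: "\<And>x t. x \<in> X \<Longrightarrow> t \<ge> 0 \<Longrightarrow> q x \<le> p (x + t *\<^sub>R x0) - t * p x0"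
    using sublinear_descent[OF p x0(1)] by metis
  obtain m where m: "sublinear m" "m \<le> q" and min: "\<And>q. sublinear q \<Longrightarrow> q \<le> m \<Longrightarrow> q = m"
    using ex_minimal_sublinear[OF q(1)] by metis
  have add: "m (x + y) = m x + m y" if "x \<in> X" "y \<in> X" for x y
    by (rule additive_if_minimal_sublinear[OF m(1) _ that]) (rule min)
  have m0: "m 0 = 0" by (rule sublinear_zero[OF m(1)])
  have neg: "m (- x) = - m x" if "x \<in> X" for x
    using add[OF that neg_mem[OF that]] m0 by simp
  have sc: "m (c *\<^sub>R x) = c * m x" if x: "x \<in> X" for c x
  proof (cases c "0 :: real" rule: linorder_cases)
    case less
    then have "m ((- c) *\<^sub>R x) = (- c) * m x" by (intro sublinear_scale[OF m(1) x]) simp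
    then show ?thesis using neg[OF scale_mem[OF x, of c]] by simp
  qed (use m0 sublinear_scale[OF m(1) x] in auto)
  have le: "m x \<le> N x" if "x \<in> X" for x
  proof -
    have "m x \<le> p x" using m(2) q(2) by (auto simp: le_fun_def intro: order_trans)
    then show ?thesis using that by (simp add: p_def)
  qed
  have ab: "\<bar>m x\<bar> \<le> 1 * N x" if "x \<in> X" for x
    using le[OF that] le[OF neg_mem[OF that]] neg[OF that] norm_scale[OF that, of "- 1"] by simp
  have dual: "m \<in> dual_space X N"
    using add sc ab m(1) by (auto simp: dual_space_def sublinear_def intro!: exI[of _ "1 :: real"])
  have "dual_norm X N m \<le> 1" by (rule dual_norm_le[OF normed_space_on_axioms ab]) auto
  moreover have "1 \<le> dual_norm X N m"
  proof -
    have "m (- x0) \<le> q (- x0)" using m(2) by (simp add: le_fun_def)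
    also have "\<dots> \<le> - N x0"
      using qt[OF neg_mem[OF x0(1)], of 1] x0(1) by (simp add: p_def zero_mem norm_zero)
    finally have "N x0 \<le> m x0" using neg[OF x0(1)] by simp
    also have "\<dots> \<le> dual_norm X N m * N x0"
      using dual_bound[OF normed_space_on_axioms dual x0(1)] by simp
    finally show ?thesis using norm_pos[OF x0] by simp
  qed
  ultimately show ?thesis using dual by (auto simp: unit_sphere_def)
qed

section \<open>Convex combinations and normalisation in a normed space\<close>

lemma sum_mem: "(\<And>k. k \<in> K \<Longrightarrow> y k \<in> X) \<Longrightarrow> sum y K \<in> X"
  by (rule subspace_sum[OF subspace])

lemma norm_sum_scale_le:
  assumes "\<And>k. k \<in> K \<Longrightarrow> y k \<in> X" "\<And>k. k \<in> K \<Longrightarrow> 0 \<le> a k"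
  shows "N (\<Sum>k\<in>K. a k *\<^sub>R y k) \<le> (\<Sum>k\<in>K. a k * N (y k))"
  using assms
proof (induction K rule: infinite_finite_induct)
  case (insert k K)
  have "N (a k *\<^sub>R y k + (\<Sum>k\<in>K. a k *\<^sub>R y k)) \<le> N (a k *\<^sub>R y k) + N (\<Sum>k\<in>K. a k *\<^sub>R y k)"
    using insert.prems by (intro norm_triangle scale_mem sum_mem) auto
  also have "\<dots> \<le> a k * N (y k) + (\<Sum>k\<in>K. a k * N (y k))"
    using insert by (auto simp: norm_scale intro!: add_mono)
  finally show ?case using insert by simp
qed (simp_all add: norm_zero)

text \<open>If the triangle inequality is an equality for one combination of the \<open>y k\<close>, it is an equality for
  every combination whose coefficients are dominated by a multiple of the first ones: fill up with the
  difference of the coefficients and use the triangle inequality for the two parts.\<close>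

lemma norm_sum_reweight:
  assumes K: "finite K" and y: "\<And>k. k \<in> K \<Longrightarrow> y k \<in> X"
    and w: "(\<Sum>k\<in>K. w k * N (y k)) \<le> N (\<Sum>k\<in>K. w k *\<^sub>R y k)"
    and M: "M \<ge> 0" and a: "\<And>k. k \<in> K \<Longrightarrow> 0 \<le> a k" "\<And>k. k \<in> K \<Longrightarrow> a k \<le> M * w k"
  shows "N (\<Sum>k\<in>K. a k *\<^sub>R y k) = (\<Sum>k\<in>K. a k * N (y k))"
proof (rule antisym)
  show "N (\<Sum>k\<in>K. a k *\<^sub>R y k) \<le> (\<Sum>k\<in>K. a k * N (y k))"
    by (rule norm_sum_scale_le) (use y a in auto)
  let ?b = "\<lambda>k. M * w k - a k"
  have "M * (\<Sum>k\<in>K. w k * N (y k)) \<le> M * N (\<Sum>k\<in>K. w k *\<^sub>R y k)"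
    using w M by (rule mult_left_mono)
  also have "\<dots> = N (M *\<^sub>R (\<Sum>k\<in>K. w k *\<^sub>R y k))"
    using M y by (subst norm_scale) (auto intro!: sum_mem scale_mem)
  also have "M *\<^sub>R (\<Sum>k\<in>K. w k *\<^sub>R y k) = (\<Sum>k\<in>K. a k *\<^sub>R y k) + (\<Sum>k\<in>K. ?b k *\<^sub>R y k)"
    by (simp add: scaleR_sum_right algebra_simps flip: sum.distrib)
  also have "N \<dots> \<le> N (\<Sum>k\<in>K. a k *\<^sub>R y k) + N (\<Sum>k\<in>K. ?b k *\<^sub>R y k)"
    by (intro norm_triangle sum_mem scale_mem y)
  also have "N (\<Sum>k\<in>K. ?b k *\<^sub>R y k) \<le> (\<Sum>k\<in>K. ?b k * N (y k))"
    by (rule norm_sum_scale_le) (use y a in auto)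
  also have "\<dots> = M * (\<Sum>k\<in>K. w k * N (y k)) - (\<Sum>k\<in>K. a k * N (y k))"
    by (simp add: sum_distrib_left algebra_simps sum_subtractf)
  finally show "(\<Sum>k\<in>K. a k * N (y k)) \<le> N (\<Sum>k\<in>K. a k *\<^sub>R y k)" by simp
qed

lemma normalise_mem: "x \<in> X \<Longrightarrow> x \<noteq> 0 \<Longrightarrow> (1 / N x) *\<^sub>R x \<in> unit_sphere X N"
  using norm_pos[of x] by (simp add: unit_sphere_def scale_mem norm_scale)

lemma dual_norm_le_if_bound: "f \<in> dual_space X N \<Longrightarrow> x \<in> X \<Longrightarrow> dual_norm X N f \<le> K \<Longrightarrow> \<bar>f x\<bar> \<le> K * N x"
  using dual_bound[OF normed_space_on_axioms, of f x] norm_nonneg[of x]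
  by (meson mult_right_mono order_trans)

lemma dual_scale: "f \<in> dual_space X N \<Longrightarrow> x \<in> X \<Longrightarrow> f (c *\<^sub>R x) = c * f x"
  and dual_add: "f \<in> dual_space X N \<Longrightarrow> x \<in> X \<Longrightarrow> y \<in> X \<Longrightarrow> f (x + y) = f x + f y"
  and dual_outside: "f \<in> dual_space X N \<Longrightarrow> x \<notin> X \<Longrightarrow> f x = 0"
  by (auto simp: dual_space_def)

lemma dual_zero: "f \<in> dual_space X N \<Longrightarrow> f 0 = 0"
  using dual_scale[of f 0 0] zero_mem by simp

lemma dual_scale_mem:
  assumes f: "f \<in> dual_space X N"
  shows "c *\<^sub>R f \<in> dual_space X N"
proof -
  have "\<bar>c * f x\<bar> \<le> (\<bar>c\<bar> * dual_norm X N f) * N x" if "x \<in> X" for x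
    using dual_bound[OF normed_space_on_axioms f that]
    by (simp add: abs_mult mult_left_mono mult.assoc)
  then have "\<exists>K. \<forall>x\<in>X. \<bar>c * f x\<bar> \<le> K * N x" by blast
  then show ?thesis
    using f by (simp add: dual_space_def scaleR_fun_def distrib_left)
qed

lemma dual_norm_nonneg:
  assumes f: "f \<in> dual_space X N"
  shows "0 \<le> dual_norm X N f"
proof (cases "X = {0}")
  case True
  then have "unit_ball X N = {0}" using norm_zero by (auto simp: unit_ball_def)
  then show ?thesis by (simp add: dual_norm_def)
next
  case False
  then obtain x where x: "x \<in> X" "x \<noteq> 0" using zero_mem by blast
  have "0 \<le> dual_norm X N f * N x" using dual_bound[OF normed_space_on_axioms f x(1)] by simp
  then show ?thesis using norm_pos[OF x] by (simp add: zero_le_mult_iff)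
qed

lemma normalise_dual:
  assumes f: "f \<in> dual_space X N" and pos: "dual_norm X N f > 0"
  shows "dual_norm X N ((1 / dual_norm X N f) *\<^sub>R f) = 1"
proof -
  define D where "D = dual_norm X N f"
  define g where "g = (1 / D) *\<^sub>R f"
  have D: "D > 0" using pos by (simp add: D_def)
  have g: "g \<in> dual_space X N" unfolding g_def by (rule dual_scale_mem[OF f])
  have fg: "f x = D * g x" for x using D by (simp add: g_def scaleR_fun_def)
  have "dual_norm X N g \<le> 1"
  proof (rule dual_norm_le[OF normed_space_on_axioms])
    fix x assume "x \<in> X"
    then have "D * \<bar>g x\<bar> \<le> D * N x"
      using dual_bound[OF normed_space_on_axioms f] D by (auto simp: fg abs_mult D_def)
    then show "\<bar>g x\<bar> \<le> 1 * N x" using D by simp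
  qed simp
  moreover have "1 \<le> dual_norm X N g"
  proof -
    have "\<bar>f x\<bar> \<le> (D * dual_norm X N g) * N x" if "x \<in> X" for x
      using dual_bound[OF normed_space_on_axioms g that] D by (simp add: fg abs_mult mult.assoc)
    then have "D \<le> D * dual_norm X N g"
      by (subst (1) D_def) (rule dual_norm_le[OF normed_space_on_axioms], use D dual_norm_nonneg[OF g] in auto)
    then show ?thesis using D by simp
  qed
  ultimately show ?thesis by (simp add: g_def D_def)
qed

text \<open>Rescaling a functional from the ball to the sphere only increases its positive values; the
  nonempty set \<open>B\<close> guarantees that there is something to rescale.\<close>

lemma ex_sphere_functional:
  assumes g: "g \<in> dual_space X N" "dual_norm X N g \<le> 1"
    and B: "B \<subseteq> unit_sphere X N" "B \<noteq> {}" and s: "0 < s" "\<And>y. y \<in> B \<Longrightarrow> s \<le> g y"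
  obtains f where "f \<in> unit_sphere (dual_space X N) (dual_norm X N)" "\<And>y. y \<in> B \<Longrightarrow> s \<le> f y"
proof -
  define D where "D = dual_norm X N g"
  have le: "s \<le> D" if "y \<in> B" for y
  proof -
    have "y \<in> X" "N y = 1" using that B(1) by (auto simp: unit_sphere_def)
    then have "g y \<le> D" using dual_bound[OF normed_space_on_axioms g(1), of y] by (simp add: D_def)
    then show ?thesis using s(2)[OF that] by simp
  qed
  have D: "0 < D" "D \<le> 1" using B(2) le s(1) g(2) by (force simp: D_def)+
  show thesis
  proof (rule that[of "(1 / D) *\<^sub>R g"])
    show "(1 / D) *\<^sub>R g \<in> unit_sphere (dual_space X N) (dual_norm X N)"
      using normalise_dual[OF g(1)] D by (simp add: unit_sphere_def dual_scale_mem[OF g(1)] D_def)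
    fix y assume "y \<in> B"
    then have "s \<le> g y" by (rule s(2))
    moreover have "s * D \<le> s * 1" using D s(1) by (intro mult_left_mono) auto
    ultimately show "s \<le> ((1 / D) *\<^sub>R g) y" using D by (simp add: scaleR_fun_def field_simps)
  qed
qed

text \<open>A slice is closed, but its level \<open>1 - e\<close> is strictly below the norm of the functional, so the norm
  need not be attained.\<close>

lemma slice_nonempty:
  assumes f: "f \<in> dual_space X N" "dual_norm X N f = 1" and e: "0 < e" "e < 1"
  shows "slice X N f e \<noteq> {}"
proof
  assume empty: "slice X N f e = {}"
  have "\<bar>f x\<bar> \<le> (1 - e) * N x" if x: "x \<in> X" for x
  proof (cases "x = 0")
    case True
    then show ?thesis using dual_zero[OF f(1)] norm_zero by simp
  next
    case False
    have pos: "N x > 0" by (rule norm_pos[OF x False])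
    have "f (c *\<^sub>R x) < 1 - e" if "\<bar>c\<bar> = 1 / N x" for c
      using empty that pos scale_mem[OF x, of c] norm_scale[OF x, of c]
      by (force simp: slice_def unit_ball_def)
    from this[of "1 / N x"] this[of "- (1 / N x)"]
    have "\<bar>(1 / N x) * f x\<bar> < 1 - e" using pos by (simp add: dual_scale[OF f(1) x] del: scaleR_minus_left)
    then show ?thesis using pos by (simp add: abs_mult field_simps)
  qed
  then have "dual_norm X N f \<le> 1 - e"
    by (rule dual_norm_le[OF normed_space_on_axioms]) (use e in auto)
  then show False using f(2) e by simp
qed

end

lemma ASD2P_obtain:
  fixes w :: "nat \<Rightarrow> real"
  assumes P: "ASD2P X N Y"
    and w: "\<And>k. k < n \<Longrightarrow> 0 \<le> w k" "(\<Sum>k<n. w k) = 1"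
    and f: "\<And>k. k < n \<Longrightarrow> f k \<in> unit_sphere Y (dual_norm X N)"
    and e: "\<And>k. k < n \<Longrightarrow> 0 < e k" "\<And>k. k < n \<Longrightarrow> e k < 1"
  obtains s where "\<And>k. k < n \<Longrightarrow> s k \<in> slice X N (f k) (e k)"
    "(\<Sum>k<n. w k *\<^sub>R s k) \<in> unit_sphere X N"
proof -
  have slices: "\<forall>k<n. \<exists>g d. g \<in> unit_sphere Y (dual_norm X N) \<and> 0 < d \<and> d < 1 \<and>
      slice X N (f k) (e k) = slice X N g d"
    using f e by metis
  have "{\<Sum>k<n. w k *\<^sub>R s k | s. \<forall>k<n. s k \<in> slice X N (f k) (e k)} \<inter> unit_sphere X N \<noteq> {}"
    by (rule P[unfolded ASD2P_def, rule_format]) (use w slices in simp)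
  then show thesis using that by auto
qed

section \<open>Coordinates in the \<open>\<ell>\<^sub>1\<close>-sum\<close>

text \<open>Used for families of vectors as well as for families of functionals.\<close>

definition embed :: "'i \<Rightarrow> 'v::zero \<Rightarrow> 'i \<Rightarrow> 'v" where
  "embed i u = (\<lambda>_. 0)(i := u)"

lemma embed_apply: "embed i u j = (if j = i then u else 0)"
  by (simp add: embed_def)

lemma sum_apply: "(\<Sum>k\<in>K. g k) i = (\<Sum>k\<in>K. g k i)"
  for g :: "'k \<Rightarrow> 'i \<Rightarrow> 'v::comm_monoid_add"
  by (induction K rule: infinite_finite_induct) simp_all

locale dual_pair_family =
  fixes X :: "'i \<Rightarrow> 'a::real_vector set"
    and N :: "'i \<Rightarrow> 'a \<Rightarrow> real"
    and Y :: "'i \<Rightarrow> ('a \<Rightarrow> real) set"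
  assumes normed: "\<And>i. normed_space_on (X i) (N i)"
    and nontrivial: "\<And>i. X i \<noteq> {0}"
    and Y_dual: "\<And>i. Y i \<subseteq> dual_space (X i) (N i)"
    and Y_subspace: "\<And>i. subspace (Y i)"
begin

sublocale coord: normed_space_on "X i" "N i" for i
  by (rule normed)

sublocale l1: normed_space_on "l1_space X N" "l1_norm N"
  by (rule l1_normed_space[OF normed])

abbreviation "L \<equiv> l1_space X N"
abbreviation "N1 \<equiv> l1_norm N"
abbreviation "dual i \<equiv> dual_space (X i) (N i)"
abbreviation "dnorm i \<equiv> dual_norm (X i) (N i)"
abbreviation "dual1 \<equiv> dual_space L N1"
abbreviation "dnorm1 \<equiv> dual_norm L N1"
abbreviation "Yinf \<equiv> linf_space X N Y"

lemma l1_coord: "x \<in> L \<Longrightarrow> x i \<in> X i"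
  and l1_summable: "x \<in> L \<Longrightarrow> (\<lambda>i. N i (x i)) summable_on UNIV"
  by (auto simp: l1_space_def)

lemma finite_support_l1:
  assumes I: "finite I" and x: "\<And>i. x i \<in> X i" "\<And>i. i \<notin> I \<Longrightarrow> x i = 0"
  shows "x \<in> L" "N1 x = (\<Sum>i\<in>I. N i (x i))"
proof -
  have "((\<lambda>i. N i (x i)) has_sum (\<Sum>i\<in>I. N i (x i))) UNIV"
    by (rule has_sum_finite_neutralI[OF I]) (use x in \<open>auto simp: coord.norm_zero\<close>)
  then show "x \<in> L" "N1 x = (\<Sum>i\<in>I. N i (x i))"
    using x by (auto simp: l1_space_def l1_norm_def summable_on_def infsumI)
qed

lemma embed_mem: "u \<in> X i \<Longrightarrow> embed i u \<in> L"
  and embed_norm: "u \<in> X i \<Longrightarrow> N1 (embed i u) = N i u"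
  using finite_support_l1[of "{i}" "embed i u"] by (auto simp: embed_apply coord.zero_mem)

lemma embed_sphere: "u \<in> unit_sphere (X i) (N i) \<Longrightarrow> embed i u \<in> unit_sphere L N1"
  by (simp add: unit_sphere_def embed_mem embed_norm)

lemma embed_rest: "x = embed i (x i) + x(i := 0)"
  for x :: "'i \<Rightarrow> 'a"
  by (auto simp: embed_apply fun_eq_iff)

lemma rest_mem:
  assumes x: "x \<in> L"
  shows "x(i := 0) \<in> L"
proof -
  have "(\<lambda>j. N j ((x(i := 0)) j)) summable_on UNIV"
    by (rule summable_on_comparison_test[OF l1_summable[OF x]])
      (use x in \<open>auto simp: coord.norm_zero coord.norm_nonneg l1_coord\<close>)
  then show ?thesis using l1_coord[OF x] by (auto simp: l1_space_def coord.zero_mem)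
qed

lemma norm_split:
  assumes x: "x \<in> L"
  shows "N1 x = N i (x i) + N1 (x(i := 0))"
proof -
  have "N1 x = (\<Sum>\<^sub>\<infinity>j. N j (embed i (x i) j) + N j ((x(i := 0)) j))"
    unfolding l1_norm_def by (rule infsum_cong) (simp add: embed_apply coord.norm_zero)
  also have "\<dots> = N1 (embed i (x i)) + N1 (x(i := 0))"
    unfolding l1_norm_def
    by (intro infsum_add l1_summable embed_mem l1_coord rest_mem x)
  finally show ?thesis by (simp add: embed_norm l1_coord x)
qed

lemma coord_norm_le: "x \<in> L \<Longrightarrow> N i (x i) \<le> N1 x"
  using norm_split[of x i] l1.norm_nonneg[OF rest_mem, of x i] by simp

text \<open>Equal to the \<open>i\<close>-th member of the family that represents \<open>F\<close>.  The value \<open>0\<close> outside \<open>X i\<close>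
  makes it an element of the dual in its canonical representation.\<close>

definition coord :: "'i \<Rightarrow> (('i \<Rightarrow> 'a) \<Rightarrow> real) \<Rightarrow> 'a \<Rightarrow> real" where
  "coord i F u = (if u \<in> X i then F (embed i u) else 0)"

lemma coord_action:
  assumes f: "\<And>j. f j \<in> dual j"
  shows "coord i (l1_action X N f) = f i"
proof
  fix u
  show "coord i (l1_action X N f) u = f i u"
  proof (cases "u \<in> X i")
    case True
    have "((\<lambda>j. f j (embed i u j)) has_sum f i u) UNIV"
      by (rule has_sum_finite_neutralI[of "{i}"])
        (auto simp: embed_apply coord.dual_zero[OF f])
    then show ?thesis using True by (simp add: coord_def l1_action_def embed_mem infsumI)
  next
    case False
    then show ?thesis using coord.dual_outside[OF f] by (simp add: coord_def)
  qed
qed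

text \<open>The estimate behind the duality of \<open>\<ell>\<^sub>1\<close>- and \<open>\<ell>\<^sub>\<infinity>\<close>-sums.  Together with \<open>coord_dual_norm_le\<close>
  below it says that the norm of a family is the supremum of the norms of its members.\<close>

lemma action_bound:
  assumes f: "\<And>j. f j \<in> dual j" and K: "\<And>j. dnorm j (f j) \<le> K" and x: "x \<in> L"
  shows "\<bar>l1_action X N f x\<bar> \<le> K * N1 x"
proof -
  have b: "\<bar>f j (x j)\<bar> \<le> K * N j (x j)" for j
    by (rule coord.dual_norm_le_if_bound[OF f l1_coord[OF x] K])
  have s: "(\<lambda>j. K * N j (x j)) summable_on UNIV"
    by (intro summable_on_cmult_right l1_summable x)
  have abs: "(\<lambda>j. \<bar>f j (x j)\<bar>) summable_on UNIV"
    by (rule summable_on_comparison_test[OF s]) (use b in auto)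
  then have "\<bar>l1_action X N f x\<bar> \<le> (\<Sum>\<^sub>\<infinity>j. \<bar>f j (x j)\<bar>)"
    using norm_infsum_bound[of "\<lambda>j. f j (x j)" UNIV] x by (simp add: l1_action_def)
  also have "\<dots> \<le> (\<Sum>\<^sub>\<infinity>j. K * N j (x j))" by (intro infsum_mono abs s b)
  also have "\<dots> = K * N1 x"
    unfolding l1_norm_def by (rule infsum_cmult_right) (rule l1_summable[OF x])
  finally show ?thesis .
qed

lemma Yinf_dual: "Yinf \<subseteq> dual1"
  using Y_dual unfolding dual_l1[OF normed] linf_space_def linf_families_def by blast

lemma action_mem_dual1:
  assumes "\<And>j. f j \<in> dual j" "\<And>j. dnorm j (f j) \<le> K"
  shows "l1_action X N f \<in> dual1"
  using assms unfolding dual_l1[OF normed] linf_space_def linf_families_def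
  by (auto intro!: imageI bdd_aboveI2)

lemma coord_mem_dual: "F \<in> dual1 \<Longrightarrow> coord i F \<in> dual i"
  unfolding dual_l1[OF normed] by (auto simp: linf_space_def linf_families_def coord_action)

lemma coord_mem_Y:
  assumes "F \<in> Yinf"
  shows "coord i F \<in> Y i"
proof -
  obtain f where f: "\<And>j. f j \<in> Y j" "F = l1_action X N f"
    using assms by (auto simp: linf_space_def linf_families_def)
  then have "coord i F = f i" using coord_action[of f i] Y_dual by blast
  then show ?thesis using f(1) by simp
qed

lemma coord_dual_norm_le:
  assumes F: "F \<in> dual1"
  shows "dnorm i (coord i F) \<le> dnorm1 F"
proof (rule dual_norm_le[OF normed _ l1.dual_norm_nonneg[OF F]])
  fix u assume "u \<in> X i"
  then show "\<bar>coord i F u\<bar> \<le> dnorm1 F * N i u"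
    using dual_bound[OF l1.normed_space_on_axioms F embed_mem] by (simp add: coord_def embed_norm)
qed

lemma ex_large_coord:
  assumes F: "F \<in> Yinf" "dnorm1 F = 1" and s: "0 \<le> s" "s < 1"
  shows "\<exists>i. s < dnorm i (coord i F)"
proof (rule ccontr)
  assume "\<not> ?thesis"
  then have small: "dnorm i (coord i F) \<le> s" for i by (simp add: not_less)
  obtain f where f: "\<And>j. f j \<in> Y j" "F = l1_action X N f"
    using F(1) by (auto simp: linf_space_def linf_families_def)
  have fd: "f j \<in> dual j" for j using f(1) Y_dual by blast
  have "dnorm j (f j) \<le> s" for j using small[of j] by (simp add: f(2) coord_action fd)
  then have "\<bar>F x\<bar> \<le> s * N1 x" if "x \<in> L" for x
    unfolding f(2) by (intro action_bound fd that)
  then have "dnorm1 F \<le> s" by (rule dual_norm_le[OF l1.normed_space_on_axioms]) (use s in auto)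
  then show False using F(2) s(2) by simp
qed

lemma action_mem_sphere:
  assumes g: "\<And>j. g j \<in> unit_sphere (dual j) (dnorm j)"
  shows "l1_action X N g \<in> unit_sphere dual1 dnorm1"
proof -
  have gd: "g j \<in> dual j" "dnorm j (g j) = 1" for j using g[of j] by (auto simp: unit_sphere_def)
  have G: "l1_action X N g \<in> dual1" by (rule action_mem_dual1[of _ 1]) (simp_all add: gd)
  have "dnorm1 (l1_action X N g) \<le> 1"
    by (rule dual_norm_le[OF l1.normed_space_on_axioms action_bound]) (simp_all add: gd)
  \<comment> \<open>Any index will do.\<close>
  moreover have "1 \<le> dnorm1 (l1_action X N g)"
    using coord_dual_norm_le[OF G, of undefined] by (simp add: coord_action gd)
  ultimately show ?thesis using G by (simp add: unit_sphere_def)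
qed

text \<open>The isometric copy of \<open>Y i\<close> in the \<open>\<ell>\<^sub>\<infinity>\<close>-sum; subspaces contain \<open>0\<close>, so the other coordinates
  are admissible.\<close>

definition lift :: "'i \<Rightarrow> ('a \<Rightarrow> real) \<Rightarrow> ('i \<Rightarrow> 'a) \<Rightarrow> real" where
  "lift i f = l1_action X N (embed i f)"

lemma lift_apply:
  assumes f: "f \<in> Y i" and x: "x \<in> L"
  shows "lift i f x = f (x i)"
proof -
  have "((\<lambda>j. embed i f j (x j)) has_sum f (x i)) UNIV"
    by (rule has_sum_finite_neutralI[of "{i}"]) (auto simp: embed_apply)
  then show ?thesis using x by (simp add: lift_def l1_action_def infsumI)
qed

lemma lift_mem_sphere:
  assumes f: "f \<in> unit_sphere (Y i) (dnorm i)"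
  shows "lift i f \<in> unit_sphere Yinf dnorm1"
proof -
  have fY: "f \<in> Y i" and f1: "dnorm i f = 1" using f by (auto simp: unit_sphere_def)
  have fd: "f \<in> dual i" using fY Y_dual by blast
  have mem: "embed i f j \<in> Y j" for j
    using fY subspace_0[OF Y_subspace] by (simp add: embed_apply)
  then have memd: "embed i f j \<in> dual j" for j using Y_dual by blast
  have dn: "dnorm j (embed i f j) \<le> 1" for j
  proof (cases "j = i")
    case False
    show ?thesis
      by (rule dual_norm_le[OF normed]) (use False in \<open>simp_all add: embed_apply coord.norm_nonneg\<close>)
  qed (simp add: embed_apply f1)
  have lY: "lift i f \<in> Yinf"
    using mem dn by (auto simp: lift_def linf_space_def linf_families_def intro!: imageI bdd_aboveI2)
  have "\<bar>lift i f x\<bar> \<le> 1 * N1 x" if "x \<in> L" for x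
    unfolding lift_def by (rule action_bound) (use memd dn that in auto)
  then have "dnorm1 (lift i f) \<le> 1" by (rule dual_norm_le[OF l1.normed_space_on_axioms]) auto
  moreover have "coord i (lift i f) = f"
    unfolding lift_def using coord_action[of "embed i f" i] memd by (simp add: embed_apply)
  then have "1 \<le> dnorm1 (lift i f)"
    using coord_dual_norm_le[of "lift i f" i] subsetD[OF Yinf_dual lY] f1 by metis
  ultimately show ?thesis using lY by (simp add: unit_sphere_def)
qed

section \<open>Sets of functionals: from the coordinates to the sum\<close>

text \<open>Each functional of \<open>A\<close> is allowed to contribute to every coordinate.  This choice does not depend
  on how well a coordinate approximates the norm, so it serves all norming constants at once, and
  being an image of a subset of \<open>A\<close> it is no larger than \<open>A\<close>.\<close>

definition coord_sphere :: "'i \<Rightarrow> (('i \<Rightarrow> 'a) \<Rightarrow> real) set \<Rightarrow> ('a \<Rightarrow> real) set" where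
  "coord_sphere i A =
    (\<lambda>F. (1 / dnorm i (coord i F)) *\<^sub>R coord i F) ` {F \<in> A. dnorm i (coord i F) > 0}"

lemma coord_sphere_subset:
  assumes "A \<subseteq> unit_sphere Yinf dnorm1"
  shows "coord_sphere i A \<subseteq> unit_sphere (Y i) (dnorm i)"
proof -
  have "coord i F \<in> Y i" if "F \<in> A" for F
    using assms that by (auto simp: unit_sphere_def intro: coord_mem_Y)
  then show ?thesis
    using Y_dual[of i] by (auto simp: coord_sphere_def unit_sphere_def
      intro!: subspace_scale[OF Y_subspace] coord.normalise_dual)
qed

lemma card_coord_sphere:
  assumes "|A| <o \<kappa>"
  shows "|coord_sphere i A| <o \<kappa>"
proof -
  have "|coord_sphere i A| \<le>o |{F \<in> A. dnorm i (coord i F) > 0}|"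
    unfolding coord_sphere_def by (rule card_of_image)
  moreover have "|{F \<in> A. dnorm i (coord i F) > 0}| \<le>o |A|" by (rule card_of_mono1) auto
  ultimately show ?thesis using assms by (meson ordLeq_ordLess_trans)
qed

text \<open>A functional of norm one on the sum has coordinates of norm close to one, so norming vectors for
  the normalised coordinates almost norm it; the loss is arbitrarily small.\<close>

lemma lam_norms_glue:
  assumes A: "A \<subseteq> unit_sphere Yinf dnorm1" and B: "\<And>i. B i \<subseteq> X i"
    and norming: "\<And>i. lam_norms (X i) (N i) t (B i) (coord_sphere i A)"
    and s: "0 < s" "s < t"
  shows "lam_norms L N1 s (\<Union>i. embed i ` B i) A"
  unfolding lam_norms_def
proof
  fix F assume F: "F \<in> A"
  then have F1: "F \<in> Yinf" "dnorm1 F = 1" using A by (auto simp: unit_sphere_def)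
  obtain i where i: "s / t < dnorm i (coord i F)"
    using ex_large_coord[OF F1, of "s / t"] s by auto
  define D where "D = dnorm i (coord i F)"
  have "0 < s / t" using s by simp
  then have D: "0 < D" using i by (simp add: D_def)
  have "s \<le> t * D" using i s by (simp add: D_def field_simps)
  have g: "(1 / D) *\<^sub>R coord i F \<in> coord_sphere i A" using F D by (auto simp: coord_sphere_def D_def)
  then have g1: "dnorm i ((1 / D) *\<^sub>R coord i F) = 1"
    using coord_sphere_subset[OF A, of i] by (auto simp: unit_sphere_def)
  obtain u where u: "u \<in> B i" "u \<noteq> 0" "t * N i u \<le> ((1 / D) *\<^sub>R coord i F) u"
    using norming[of i] g g1 unfolding lam_norms_def by fastforce
  have uX: "u \<in> X i" using u(1) B by blast
  have "s * N i u \<le> t * D * N i u" using \<open>s \<le> t * D\<close> coord.norm_nonneg[OF uX] by (rule mult_right_mono)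
  also have "\<dots> \<le> F (embed i u)"
    using u(3) D uX by (simp add: scaleR_fun_def coord_def field_simps)
  finally have "s * dnorm1 F * N1 (embed i u) \<le> F (embed i u)" by (simp add: F1 embed_norm uX)
  moreover have "embed i u \<noteq> 0" using u(2) by (auto simp: fun_eq_iff embed_apply)
  ultimately show "\<exists>x\<in>(\<Union>i. embed i ` B i) - {0}. s * dnorm1 F * N1 x \<le> F x" using u(1) by blast
qed

lemma action_embed:
  "(\<And>j. g j \<in> dual j) \<Longrightarrow> u \<in> X i \<Longrightarrow> l1_action X N g (embed i u) = g i u"
  using coord_action[of g i] by (auto simp: coord_def fun_eq_iff split: if_splits)

text \<open>The union of the copies of the sets \<open>B i\<close> works together with the functional whose coordinates are
  the given norm-one functionals \<open>g i\<close>.  Asking the coordinates for a constant \<open>r > t\<close> pays for the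
  loss in \<open>lam_norms_glue\<close>.\<close>

lemma SD2P_less_sum:
  assumes P: "\<And>i. SD2P_less \<kappa> (X i) (N i) (Y i)"
  shows "SD2P_less \<kappa> L N1 Yinf"
  unfolding SD2P_less_def
proof (intro allI impI, elim conjE)
  fix A and t :: real
  assume A: "A \<subseteq> unit_sphere Yinf dnorm1" "|A| <o \<kappa>" and t: "0 < t" "t < 1"
  define r where "r = (1 + t) / 2"
  have r: "0 < r" "t < r" "r < 1" using t by (auto simp: r_def)
  have "\<exists>B g. B \<subseteq> unit_sphere (X i) (N i) \<and> g \<in> unit_sphere (dual i) (dnorm i) \<and>
      lam_norms (X i) (N i) r B (coord_sphere i A) \<and> (\<forall>x\<in>B. r \<le> g x)" for i
    using P[of i] coord_sphere_subset[OF A(1)] card_coord_sphere[OF A(2)] r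
    unfolding SD2P_less_def by blast
  then obtain B g where B: "\<And>i. B i \<subseteq> unit_sphere (X i) (N i)"
    and g: "\<And>i. g i \<in> unit_sphere (dual i) (dnorm i)"
    and Bn: "\<And>i. lam_norms (X i) (N i) r (B i) (coord_sphere i A)"
    and Bg: "\<And>i x. x \<in> B i \<Longrightarrow> r \<le> g i x"
    by metis
  have BX: "B i \<subseteq> X i" for i using B[of i] by (auto simp: unit_sphere_def)
  show "\<exists>B f. B \<subseteq> unit_sphere L N1 \<and> f \<in> unit_sphere dual1 dnorm1 \<and>
      lam_norms L N1 t B A \<and> (\<forall>x\<in>B. t \<le> f x)"
  proof (intro exI[of _ "\<Union>i. embed i ` B i"] exI[of _ "l1_action X N g"] conjI ballI)
    show "(\<Union>i. embed i ` B i) \<subseteq> unit_sphere L N1" using B embed_sphere by blast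
    show "l1_action X N g \<in> unit_sphere dual1 dnorm1" by (rule action_mem_sphere[OF g])
    show "lam_norms L N1 t (\<Union>i. embed i ` B i) A" by (rule lam_norms_glue[OF A(1) BX Bn t(1) r(2)])
    fix x assume "x \<in> (\<Union>i. embed i ` B i)"
    then obtain i u where u: "u \<in> B i" "x = embed i u" by blast
    moreover have "g j \<in> dual j" for j using g[of j] by (simp add: unit_sphere_def)
    ultimately have "l1_action X N g x = g i u" using BX by (auto intro: action_embed)
    then show "t \<le> l1_action X N g x" using Bg[OF u(1)] r by simp
  qed
qed

lemma one_ASD2P_less_sum:
  assumes P: "\<And>i. one_ASD2P_less \<kappa> (X i) (N i) (Y i)"
  shows "one_ASD2P_less \<kappa> L N1 Yinf"
  unfolding one_ASD2P_less_def
proof (intro allI impI, elim conjE)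
  fix A
  assume A: "A \<subseteq> unit_sphere Yinf dnorm1" "|A| <o \<kappa>"
  have "\<exists>B g. B \<subseteq> unit_sphere (X i) (N i) \<and> g \<in> unit_sphere (dual i) (dnorm i) \<and>
      norms (X i) (N i) B (coord_sphere i A) \<and> (\<forall>x\<in>B. g x = 1)" for i
    using P[of i] coord_sphere_subset[OF A(1)] card_coord_sphere[OF A(2)]
    unfolding one_ASD2P_less_def by blast
  then obtain B g where B: "\<And>i. B i \<subseteq> unit_sphere (X i) (N i)"
    and g: "\<And>i. g i \<in> unit_sphere (dual i) (dnorm i)"
    and Bn: "\<And>i. norms (X i) (N i) (B i) (coord_sphere i A)"
    and Bg: "\<And>i x. x \<in> B i \<Longrightarrow> g i x = 1"
    by metis
  have BX: "B i \<subseteq> X i" for i using B[of i] by (auto simp: unit_sphere_def)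
  show "\<exists>B f. B \<subseteq> unit_sphere L N1 \<and> f \<in> unit_sphere dual1 dnorm1 \<and>
      norms L N1 B A \<and> (\<forall>x\<in>B. f x = 1)"
  proof (intro exI[of _ "\<Union>i. embed i ` B i"] exI[of _ "l1_action X N g"] conjI ballI)
    show "(\<Union>i. embed i ` B i) \<subseteq> unit_sphere L N1" using B embed_sphere by blast
    show "l1_action X N g \<in> unit_sphere dual1 dnorm1" by (rule action_mem_sphere[OF g])
    show "norms L N1 (\<Union>i. embed i ` B i) A"
      unfolding norms_def
    proof (intro allI impI, elim conjE)
      fix s :: real assume s: "0 < s" "s < 1"
      have "lam_norms (X i) (N i) ((1 + s) / 2) (B i) (coord_sphere i A)" for i
        using Bn[of i] s by (simp add: norms_def)
      then show "lam_norms L N1 s (\<Union>i. embed i ` B i) A"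
        by (rule lam_norms_glue[OF A(1) BX]) (use s in auto)
    qed
    fix x assume "x \<in> (\<Union>i. embed i ` B i)"
    then obtain i u where u: "u \<in> B i" "x = embed i u" by blast
    moreover have "g j \<in> dual j" for j using g[of j] by (simp add: unit_sphere_def)
    ultimately have "l1_action X N g x = g i u" using BX by (auto intro: action_embed)
    then show "l1_action X N g x = 1" using Bg[OF u(1)] by simp
  qed
qed

section \<open>Sets of functionals: from the sum to a coordinate\<close>

text \<open>The part of \<open>x\<close> outside the coordinate \<open>i\<close> has norm \<open>1 - N i (x i)\<close>, hence it contributes at most
  that much to \<open>G x\<close>.\<close>

lemma coord_functional_lower:
  assumes G: "G \<in> dual1" "dnorm1 G \<le> 1" and x: "x \<in> L" "N1 x = 1"
  shows "G x \<le> coord i G (x i) + (1 - N i (x i))"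
proof -
  have "G x = G (embed i (x i)) + G (x(i := 0))"
    by (subst embed_rest[of x i]) (intro l1.dual_add G embed_mem l1_coord rest_mem x)
  also have "G (x(i := 0)) \<le> N1 (x(i := 0))"
    using l1.dual_norm_le_if_bound[OF G(1) rest_mem[OF x(1)] G(2), of i] by simp
  also have "\<dots> = 1 - N i (x i)" using norm_split[OF x(1), of i] x(2) by simp
  finally show ?thesis using l1_coord[OF x(1), of i] by (simp add: coord_def)
qed

text \<open>The parameter \<open>b\<close> discards vectors with a small coordinate at \<open>i\<close>: if \<open>G x \<ge> c\<close>, then
  \<open>coord_functional_lower\<close> and normalisation give the lower bound \<open>1 - (1 - c) / N i (x i)\<close>, which is
  useless for small \<open>N i (x i)\<close> unless \<open>c = 1\<close>.\<close>

definition proj_sphere :: "'i \<Rightarrow> real \<Rightarrow> ('i \<Rightarrow> 'a) set \<Rightarrow> 'a set" where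
  "proj_sphere i b B = (\<lambda>x. (1 / N i (x i)) *\<^sub>R x i) ` {x \<in> B. x i \<noteq> 0 \<and> b \<le> N i (x i)}"

lemma proj_sphere_subset: "B \<subseteq> L \<Longrightarrow> proj_sphere i b B \<subseteq> unit_sphere (X i) (N i)"
  by (auto simp: proj_sphere_def intro!: coord.normalise_mem l1_coord)

text \<open>A lifted functional \<open>f\<close> sees only the coordinate \<open>x i\<close>, so a vector that norms it has
  \<open>N i (x i) \<ge> f (x i) \<ge> t\<close>, and normalising \<open>x i\<close> can only increase the value of \<open>f\<close>.\<close>

lemma lam_norms_proj:
  assumes A: "A \<subseteq> unit_sphere (Y i) (dnorm i)" and B: "B \<subseteq> unit_sphere L N1"
    and norming: "lam_norms L N1 t B (lift i ` A)" and t: "0 < t" "b \<le> t"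
  shows "lam_norms (X i) (N i) t (proj_sphere i b B) A"
  unfolding lam_norms_def
proof
  fix f assume fA: "f \<in> A"
  then have f: "f \<in> Y i" "f \<in> dual i" "dnorm i f = 1" using A Y_dual by (auto simp: unit_sphere_def)
  have l: "dnorm1 (lift i f) = 1" using lift_mem_sphere[of f i] fA A by (auto simp: unit_sphere_def)
  obtain x where xB: "x \<in> B" and x: "x \<in> L" "N1 x = 1" and xt: "t \<le> lift i f x"
    using norming fA l B unfolding lam_norms_def unit_sphere_def by fastforce
  have fx: "t \<le> f (x i)" using xt by (simp add: lift_apply f x)
  also have fN: "\<dots> \<le> N i (x i)"
    using coord.dual_norm_le_if_bound[OF f(2) l1_coord[OF x(1)], of 1] f(3) by simp
  finally have tN: "t \<le> N i (x i)" .
  have x0: "x i \<noteq> 0" using fx t f(2) by (auto simp: coord.dual_zero)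
  define y where "y = (1 / N i (x i)) *\<^sub>R x i"
  have y: "y \<in> proj_sphere i b B" using xB x0 tN t by (auto simp: proj_sphere_def y_def)
  have y1: "y \<in> X i" "N i y = 1"
    using coord.normalise_mem[OF l1_coord[OF x(1)] x0] by (auto simp: unit_sphere_def y_def)
  then have "y \<noteq> 0" using coord.norm_zero[of i] by fastforce
  moreover have "t \<le> f y"
  proof -
    have "t * N i (x i) \<le> t * 1" using coord_norm_le[OF x(1), of i] x(2) t by (intro mult_left_mono) auto
    then have "t * N i (x i) \<le> f (x i)" using fx by simp
    then show ?thesis using tN t by (simp add: y_def coord.dual_scale[OF f(2) l1_coord[OF x(1)]] field_simps)
  qed
  ultimately show "\<exists>x\<in>proj_sphere i b B - {0}. t * dnorm i f * N i x \<le> f x"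
    using y y1 f(3) by (intro bexI[of _ y]) simp_all
qed

lemma proj_functional_lower:
  assumes G: "G \<in> unit_sphere dual1 dnorm1" and B: "B \<subseteq> unit_sphere L N1"
    and c: "\<And>x. x \<in> B \<Longrightarrow> c \<le> G x"
    and s: "\<And>r. 0 < r \<Longrightarrow> b \<le> r \<Longrightarrow> r \<le> 1 \<Longrightarrow> s * r \<le> c - (1 - r)"
    and y: "y \<in> proj_sphere i b B"
  shows "s \<le> coord i G y"
proof -
  have G1: "G \<in> dual1" "dnorm1 G \<le> 1" using G by (auto simp: unit_sphere_def)
  obtain x where xB: "x \<in> B" and x0: "x i \<noteq> 0" and xb: "b \<le> N i (x i)"
    and y: "y = (1 / N i (x i)) *\<^sub>R x i"
    using y by (auto simp: proj_sphere_def)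
  have x: "x \<in> L" "N1 x = 1" using B xB by (auto simp: unit_sphere_def)
  have pos: "0 < N i (x i)" by (rule coord.norm_pos[OF l1_coord[OF x(1)] x0])
  have "s * N i (x i) \<le> c - (1 - N i (x i))"
    using coord_norm_le[OF x(1), of i] x(2) by (intro s pos xb) simp
  also have "\<dots> \<le> coord i G (x i)" using coord_functional_lower[OF G1 x, of i] c[OF xB] by simp
  finally show ?thesis
    using pos by (simp add: y coord.dual_scale[OF coord_mem_dual[OF G1(1)] l1_coord[OF x(1)]] field_simps)
qed

lemma card_lift: "|A| <o \<kappa> \<Longrightarrow> |lift i ` A| <o \<kappa>"
  using card_of_image[of "lift i" A] by (rule ordLeq_ordLess_trans)

lemma lift_image_sphere:
  "A \<subseteq> unit_sphere (Y i) (dnorm i) \<Longrightarrow> lift i ` A \<subseteq> unit_sphere Yinf dnorm1"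
  using lift_mem_sphere by blast

text \<open>Project a set that norms the lifted functionals.  For empty \<open>A\<close> there may be no vectors to project,
  and then only a functional of norm one is needed.\<close>

lemma SD2P_less_coord:
  assumes P: "SD2P_less \<kappa> L N1 Yinf"
  shows "SD2P_less \<kappa> (X i) (N i) (Y i)"
  unfolding SD2P_less_def
proof (intro allI impI, elim conjE)
  fix A and t :: real
  assume A: "A \<subseteq> unit_sphere (Y i) (dnorm i)" "|A| <o \<kappa>" and t: "0 < t" "t < 1"
  show "\<exists>B f. B \<subseteq> unit_sphere (X i) (N i) \<and> f \<in> unit_sphere (dual i) (dnorm i) \<and>
      lam_norms (X i) (N i) t B A \<and> (\<forall>x\<in>B. t \<le> f x)"
  proof (cases "A = {}")
    case True
    then show ?thesis using coord.ex_dual_norm_1[OF nontrivial, of i]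
      by (intro exI[of _ "{}"]) (auto simp: lam_norms_def)
  next
    case False
    \<comment> \<open>This \<open>m\<close> solves \<open>1 - (1 - m) / m = t\<close>, the bound left after normalisation.\<close>
    define m where "m = 1 / (2 - t)"
    have m: "0 < m" "m < 1" "(2 - t) * m = 1" using t by (auto simp: m_def)
    have "t * (2 - t) \<le> 1" using zero_le_power2[of "1 - t"] by (simp add: power2_eq_square algebra_simps)
    then have tm: "t \<le> m" using t by (simp add: m_def field_simps)
    obtain B G where B: "B \<subseteq> unit_sphere L N1" and G: "G \<in> unit_sphere dual1 dnorm1"
      and Bn: "lam_norms L N1 m B (lift i ` A)" and BG: "\<And>x. x \<in> B \<Longrightarrow> m \<le> G x"
      using P lift_image_sphere[OF A(1)] card_lift[OF A(2)] m unfolding SD2P_less_def by metis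
    let ?B = "proj_sphere i m B"
    have G1: "coord i G \<in> dual i" "dnorm i (coord i G) \<le> 1"
      using G coord_dual_norm_le[of G i] by (auto simp: unit_sphere_def intro: coord_mem_dual)
    have nm: "lam_norms (X i) (N i) m ?B A" by (rule lam_norms_proj[OF A(1) B Bn m(1)]) simp
    have sub: "?B \<subseteq> unit_sphere (X i) (N i)"
      by (rule proj_sphere_subset) (use B in \<open>auto simp: unit_sphere_def\<close>)
    have ne: "?B \<noteq> {}" using nm False by (auto simp: lam_norms_def)
    have low: "t \<le> coord i G y" if "y \<in> ?B" for y
    proof (rule proj_functional_lower[OF G B BG _ that])
      fix r assume "m \<le> r"
      then have "(1 - t) * m \<le> (1 - t) * r" using t by (intro mult_left_mono) auto
      then show "t * r \<le> m - (1 - r)" using m(3) by (simp add: algebra_simps)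
    qed
    obtain f where f: "f \<in> unit_sphere (dual i) (dnorm i)" "\<And>y. y \<in> ?B \<Longrightarrow> t \<le> f y"
      using coord.ex_sphere_functional[OF G1 sub ne t(1) low] by metis
    have "lam_norms (X i) (N i) t ?B A"
      unfolding lam_norms_def
    proof
      fix h assume h: "h \<in> A"
      obtain x where x: "x \<in> ?B - {0}" "m * dnorm i h * N i x \<le> h x"
        using nm h by (auto simp: lam_norms_def)
      have "dnorm i h = 1" "N i x = 1" using h A sub x by (auto simp: unit_sphere_def)
      then show "\<exists>x\<in>?B - {0}. t * dnorm i h * N i x \<le> h x"
        by (intro bexI[OF _ x(1)]) (use x(2) tm in simp)
    qed
    then show ?thesis using sub f by blast
  qed
qed

text \<open>The projection loses nothing where \<open>G x = 1\<close>, so all vectors with nonzero coordinate are kept and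
  a single set norms \<open>A\<close> for every constant.\<close>

lemma one_ASD2P_less_coord:
  assumes P: "one_ASD2P_less \<kappa> L N1 Yinf"
  shows "one_ASD2P_less \<kappa> (X i) (N i) (Y i)"
  unfolding one_ASD2P_less_def
proof (intro allI impI, elim conjE)
  fix A
  assume A: "A \<subseteq> unit_sphere (Y i) (dnorm i)" "|A| <o \<kappa>"
  show "\<exists>B f. B \<subseteq> unit_sphere (X i) (N i) \<and> f \<in> unit_sphere (dual i) (dnorm i) \<and>
      norms (X i) (N i) B A \<and> (\<forall>x\<in>B. f x = 1)"
  proof (cases "A = {}")
    case True
    then show ?thesis using coord.ex_dual_norm_1[OF nontrivial, of i]
      by (intro exI[of _ "{}"]) (auto simp: norms_def lam_norms_def)
  next
    case False
    obtain B G where B: "B \<subseteq> unit_sphere L N1" and G: "G \<in> unit_sphere dual1 dnorm1"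
      and Bn: "norms L N1 B (lift i ` A)" and BG: "\<And>x. x \<in> B \<Longrightarrow> G x = 1"
      using P lift_image_sphere[OF A(1)] card_lift[OF A(2)] unfolding one_ASD2P_less_def by metis
    let ?B = "proj_sphere i 0 B"
    have G1: "coord i G \<in> dual i" "dnorm i (coord i G) \<le> 1"
      using G coord_dual_norm_le[of G i] by (auto simp: unit_sphere_def intro: coord_mem_dual)
    have nm: "norms (X i) (N i) ?B A"
      using Bn by (auto simp: norms_def intro!: lam_norms_proj[OF A(1) B])
    have sub: "?B \<subseteq> unit_sphere (X i) (N i)"
      by (rule proj_sphere_subset) (use B in \<open>auto simp: unit_sphere_def\<close>)
    have "lam_norms (X i) (N i) (1 / 2) ?B A" using nm by (simp add: norms_def)
    then have ne: "?B \<noteq> {}" using False by (auto simp: lam_norms_def)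
    have low: "1 \<le> coord i G y" if "y \<in> ?B" for y
      by (rule proj_functional_lower[OF G B _ _ that, of 1]) (use BG in auto)
    obtain f where f: "f \<in> unit_sphere (dual i) (dnorm i)" "\<And>y. y \<in> ?B \<Longrightarrow> 1 \<le> f y"
      using coord.ex_sphere_functional[OF G1 sub ne zero_less_one low] by metis
    have "f y = 1" if y: "y \<in> ?B" for y
    proof (rule antisym)
      have "y \<in> X i" "N i y = 1" using sub y by (auto simp: unit_sphere_def)
      then show "f y \<le> 1"
        using coord.dual_norm_le_if_bound[of f i y 1] f(1) by (auto simp: unit_sphere_def)
    qed (rule f(2)[OF y])
    then show ?thesis using sub f(1) nm by blast
  qed
qed

section \<open>Convex combinations of slices\<close>

text \<open>Every slice of the ball of the sum contains a copy of a slice of the ball of some \<open>X (\<iota> k)\<close>.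
  Collect the indices \<open>k\<close> with the same \<open>\<iota> k = i\<close>; after dividing their weights by the total weight
  \<open>W i\<close>, the hypothesis for \<open>X i\<close> gives a combination of norm \<open>W i\<close>.  Combinations that live in
  different coordinates add their norms, and the \<open>W i\<close> add up to \<open>1\<close>.\<close>

lemma ASD2P_sum:
  assumes P: "\<And>i. ASD2P (X i) (N i) (Y i)"
  shows "ASD2P L N1 Yinf"
  unfolding ASD2P_def
proof (intro allI impI, elim conjE)
  fix n :: nat and w :: "nat \<Rightarrow> real" and S
  assume w: "\<forall>k<n. 0 \<le> w k" "(\<Sum>k<n. w k) = 1"
    and S: "\<forall>k<n. \<exists>F e. F \<in> unit_sphere Yinf dnorm1 \<and> 0 < e \<and> e < 1 \<and> S k = slice L N1 F e"
  \<comment> \<open>Each slice contains a copy of a slice of one of the coordinate balls.\<close>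
  have "\<exists>i g d. g \<in> unit_sphere (Y i) (dnorm i) \<and> 0 < d \<and> d < 1 \<and>
      embed i ` slice (X i) (N i) g d \<subseteq> S k" if k: "k < n" for k
  proof -
    obtain F e where F: "F \<in> Yinf" "dnorm1 F = 1" and e: "0 < e" "e < 1"
      and Sk: "S k = slice L N1 F e"
      using S k by (auto simp: unit_sphere_def)
    obtain i where i: "1 - e < dnorm i (coord i F)" using ex_large_coord[OF F, of "1 - e"] e by auto
    define D where "D = dnorm i (coord i F)"
    have "D \<le> 1" using coord_dual_norm_le[of F i] F Yinf_dual by (auto simp: D_def)
    then have D: "1 - e < D" "0 < D" "D \<le> 1" using i e by (auto simp: D_def)
    define d where "d = 1 - (1 - e) / D"
    have d: "0 < d" "d < 1" "(1 - d) * D = 1 - e" using D e by (auto simp: d_def field_simps)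
    define g where "g = (1 / D) *\<^sub>R coord i F"
    have "g \<in> unit_sphere (Y i) (dnorm i)"
      using coord_sphere_subset[of "{F}" i] F D by (auto simp: coord_sphere_def unit_sphere_def g_def D_def)
    moreover have "embed i u \<in> S k" if u: "u \<in> slice (X i) (N i) g d" for u
    proof -
      have uX: "u \<in> X i" "N i u \<le> 1" and gu: "1 - d \<le> g u"
        using u by (auto simp: slice_def unit_ball_def)
      have "1 - e = (1 - d) * D" by (simp add: d)
      also have "\<dots> \<le> g u * D" using gu D by (intro mult_right_mono) auto
      also have "\<dots> = F (embed i u)" using D uX by (simp add: g_def scaleR_fun_def coord_def)
      finally show ?thesis using uX by (simp add: Sk slice_def unit_ball_def embed_mem embed_norm)
    qed
    ultimately show ?thesis using d by blast
  qed
  then obtain \<iota> g d where g: "\<And>k. k < n \<Longrightarrow> g k \<in> unit_sphere (Y (\<iota> k)) (dnorm (\<iota> k))"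
    and d: "\<And>k. k < n \<Longrightarrow> 0 < d k" "\<And>k. k < n \<Longrightarrow> d k < 1"
    and sub: "\<And>k. k < n \<Longrightarrow> embed (\<iota> k) ` slice (X (\<iota> k)) (N (\<iota> k)) (g k) (d k) \<subseteq> S k"
    by metis
  define T where "T k = slice (X (\<iota> k)) (N (\<iota> k)) (g k) (d k)" for k
  have T_ne: "T k \<noteq> {}" if "k < n" for k
    using coord.slice_nonempty[of "g k" "\<iota> k" "d k"] g[OF that] d[OF that] Y_dual
    by (auto simp: T_def unit_sphere_def)
  have T_X: "T k \<subseteq> X (\<iota> k)" for k by (auto simp: T_def slice_def unit_ball_def)
  define K where "K i = {k. k < n \<and> \<iota> k = i}" for i
  define W where "W i = (\<Sum>k\<in>K i. w k)" for i
  have Kfin: "finite (K i)" for i by (simp add: K_def)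
  have w_nonneg: "0 \<le> w k" if "k \<in> K i" for i k using w(1) that by (simp add: K_def)
  have W_nonneg: "0 \<le> W i" for i unfolding W_def by (rule sum_nonneg) (rule w_nonneg)
  \<comment> \<open>In each coordinate, the slices living there have a combination of full norm.\<close>
  have "\<exists>s. (\<forall>k\<in>K i. s k \<in> T k) \<and> N i (\<Sum>k\<in>K i. w k *\<^sub>R s k) = W i" for i
  proof (cases "W i = 0")
    case True
    then have w0: "w k = 0" if "k \<in> K i" for k
      using that True sum_nonneg_eq_0_iff[of "K i" w, OF Kfin w_nonneg[of _ i]] unfolding W_def by blast
    have "\<forall>k\<in>K i. \<exists>x. x \<in> T k" using T_ne by (auto simp: K_def)
    then obtain s where "\<forall>k\<in>K i. s k \<in> T k" by metis
    then show ?thesis using True w0 by (intro exI[of _ s]) (simp add: coord.norm_zero)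
  next
    case False
    then obtain k0 where k0: "k0 \<in> K i" by (force simp: W_def)
    have Wpos: "W i > 0" using False W_nonneg[of i] by simp
    \<comment> \<open>The other indices are kept, with weight \<open>0\<close> and the slice of \<open>k0\<close>.\<close>
    define v where "v k = (if k \<in> K i then w k / W i else 0)" for k
    define \<sigma> where "\<sigma> k = (if k \<in> K i then k else k0)" for k
    have \<sigma>: "\<sigma> k \<in> K i" for k using k0 by (simp add: \<sigma>_def)
    have Ksub: "{..<n} \<inter> K i = K i" by (auto simp: K_def)
    have "(\<Sum>k<n. v k) = (\<Sum>k\<in>K i. w k / W i)"
      by (simp add: v_def sum.If_cases Ksub)
    also have "\<dots> = 1" using False by (simp add: W_def flip: sum_divide_distrib)
    finally have v1: "(\<Sum>k<n. v k) = 1" .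
    have v0: "0 \<le> v k" if "k < n" for k using w that Wpos by (simp add: v_def)
    have \<sigma>n: "\<sigma> k < n" "\<iota> (\<sigma> k) = i" for k using \<sigma>[of k] by (auto simp: K_def)
    have g\<sigma>: "g (\<sigma> k) \<in> unit_sphere (Y i) (dnorm i)" for k using g[OF \<sigma>n(1)] \<sigma>n(2) by simp
    obtain s where s: "\<And>k. k < n \<Longrightarrow> s k \<in> slice (X i) (N i) (g (\<sigma> k)) (d (\<sigma> k))"
      and "(\<Sum>k<n. v k *\<^sub>R s k) \<in> unit_sphere (X i) (N i)"
      by (rule ASD2P_obtain[OF P[of i], of n v "\<lambda>k. g (\<sigma> k)" "\<lambda>k. d (\<sigma> k)"])
        (use v0 v1 g\<sigma> d \<sigma>n in blast)+
    then have s1: "N i (\<Sum>k<n. v k *\<^sub>R s k) = 1" by (simp add: unit_sphere_def)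
    have sT: "s k \<in> T k" if "k \<in> K i" for k using s[of k] that by (simp add: \<sigma>_def T_def K_def)
    then have sX: "s k \<in> X i" if "k \<in> K i" for k using T_X[of k] that by (auto simp: K_def)
    have "(\<Sum>k\<in>K i. w k *\<^sub>R s k) = W i *\<^sub>R (\<Sum>k\<in>K i. v k *\<^sub>R s k)"
      using False by (auto simp: scaleR_sum_right v_def intro!: sum.cong)
    also have "(\<Sum>k\<in>K i. v k *\<^sub>R s k) = (\<Sum>k<n. v k *\<^sub>R s k)"
      by (rule sum.mono_neutral_left) (auto simp: K_def v_def)
    finally have "N i (\<Sum>k\<in>K i. w k *\<^sub>R s k) = N i (W i *\<^sub>R (\<Sum>k<n. v k *\<^sub>R s k))" by simp
    also have "(\<Sum>k<n. v k *\<^sub>R s k) \<in> X i"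
      by (rule coord.sum_mem) (auto simp: v_def sX coord.zero_mem intro: coord.scale_mem)
    then have "N i (W i *\<^sub>R (\<Sum>k<n. v k *\<^sub>R s k)) = W i"
      using s1 Wpos by (simp add: coord.norm_scale)
    finally show ?thesis using sT by blast
  qed
  then obtain s where sT: "\<And>i k. k \<in> K i \<Longrightarrow> s i k \<in> T k"
    and sW: "\<And>i. N i (\<Sum>k\<in>K i. w k *\<^sub>R s i k) = W i"
    by metis
  define z where "z k = embed (\<iota> k) (s (\<iota> k) k)" for k
  have zS: "z k \<in> S k" if "k < n" for k
    using sT[of k "\<iota> k"] sub[OF that] that by (auto simp: z_def K_def T_def)
  define x where "x = (\<Sum>k<n. w k *\<^sub>R z k)"
  have xi: "x i = (\<Sum>k\<in>K i. w k *\<^sub>R s i k)" for i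
  proof -
    have "x i = (\<Sum>k<n. w k *\<^sub>R z k i)" by (simp add: x_def sum_apply scaleR_fun_def)
    also have "\<dots> = (\<Sum>k\<in>K i. w k *\<^sub>R z k i)"
      by (rule sum.mono_neutral_right) (auto simp: K_def z_def embed_apply)
    also have "\<dots> = (\<Sum>k\<in>K i. w k *\<^sub>R s i k)"
      by (rule sum.cong) (auto simp: K_def z_def embed_apply)
    finally show ?thesis .
  qed
  have xX: "x i \<in> X i" for i
  proof -
    have "s i k \<in> X i" if "k \<in> K i" for k using sT[OF that] T_X[of k] that by (auto simp: K_def)
    then show ?thesis unfolding xi by (intro coord.sum_mem coord.scale_mem)
  qed
  have x0: "x i = 0" if "i \<notin> \<iota> ` {..<n}" for i
  proof -
    have "K i = {}" using that by (auto simp: K_def)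
    then show ?thesis by (simp add: xi)
  qed
  have supp: "x \<in> L" "N1 x = (\<Sum>i\<in>\<iota> ` {..<n}. N i (x i))"
    by (rule finite_support_l1[of "\<iota> ` {..<n}"], simp, rule xX, erule x0)+
  note supp(2)
  also have "(\<Sum>i\<in>\<iota> ` {..<n}. N i (x i)) = (\<Sum>i\<in>\<iota> ` {..<n}. W i)" by (simp add: xi sW)
  also have "\<dots> = (\<Sum>k<n. w k)"
    unfolding W_def K_def using sum.group[of "{..<n}" "\<iota> ` {..<n}" \<iota> w] by simp
  also have "\<dots> = 1" by (rule w(2))
  finally have "x \<in> unit_sphere L N1"
    using supp(1) by (simp add: unit_sphere_def)
  then show "{\<Sum>k<n. w k *\<^sub>R s k | s. \<forall>k<n. s k \<in> S k} \<inter> unit_sphere L N1 \<noteq> {}"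
    using zS x_def by blast
qed

lemma rest_sum: "(\<Sum>k\<in>K. w k *\<^sub>R x k)(i := 0) = (\<Sum>k\<in>K. w k *\<^sub>R (x k)(i := 0))"
  for x :: "'k \<Rightarrow> 'i \<Rightarrow> 'a"
  by (auto simp: fun_eq_iff sum_apply scaleR_fun_def)

text \<open>Lift the slices and take a norm-one combination of some \<open>x k\<close>.  The norms of its parts in and
  outside the coordinate \<open>i\<close> add up to \<open>1\<close>, which forces equality in the triangle inequality in each
  part.  In the coordinate \<open>i\<close> the equality survives the normalisation of the vectors \<open>x k i\<close>
  (\<open>norm_sum_reweight\<close>), and normalised vectors stay in their slices.\<close>

lemma ASD2P_coord:
  assumes P: "ASD2P L N1 Yinf"
  shows "ASD2P (X i) (N i) (Y i)"
  unfolding ASD2P_def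
proof (intro allI impI, elim conjE)
  fix n :: nat and w :: "nat \<Rightarrow> real" and S
  assume w: "\<forall>k<n. 0 \<le> w k" "(\<Sum>k<n. w k) = 1"
    and S: "\<forall>k<n. \<exists>f e. f \<in> unit_sphere (Y i) (dnorm i) \<and> 0 < e \<and> e < 1 \<and> S k = slice (X i) (N i) f e"
  obtain f e where f: "\<And>k. k < n \<Longrightarrow> f k \<in> unit_sphere (Y i) (dnorm i)"
    and e: "\<And>k. k < n \<Longrightarrow> 0 < e k" "\<And>k. k < n \<Longrightarrow> e k < 1"
    and Sk: "\<And>k. k < n \<Longrightarrow> S k = slice (X i) (N i) (f k) (e k)"
    using S by metis
  have fY: "f k \<in> Y i" "f k \<in> dual i" "dnorm i (f k) = 1" if "k < n" for k
    using f[OF that] Y_dual by (auto simp: unit_sphere_def)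
  obtain x where xs: "\<And>k. k < n \<Longrightarrow> x k \<in> slice L N1 (lift i (f k)) (e k)"
    and "(\<Sum>k<n. w k *\<^sub>R x k) \<in> unit_sphere L N1"
    by (rule ASD2P_obtain[OF P, of n w "\<lambda>k. lift i (f k)" e])
      (use w lift_mem_sphere[OF f] e in blast)+
  then have x1: "N1 (\<Sum>k<n. w k *\<^sub>R x k) = 1" by (simp add: unit_sphere_def)
  have xL: "x k \<in> L" "N1 (x k) \<le> 1" "1 - e k \<le> f k (x k i)" if "k < n" for k
    using xs[OF that] fY(1)[OF that] by (auto simp: slice_def unit_ball_def lift_apply)
  define y where "y k = x k i" for k
  have yX: "y k \<in> X i" if "k < n" for k using xL(1)[OF that] by (simp add: y_def l1_coord)
  have ypos: "0 < N i (y k)" if "k < n" for k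
    using xL(3)[OF that] e(2)[OF that] coord.dual_norm_le_if_bound[OF fY(2) yX, OF that that, of 1]
      fY(3)[OF that]
    by (simp add: y_def)
  have y1: "N i (y k) \<le> 1" if "k < n" for k
    using coord_norm_le[OF xL(1)[OF that], of i] xL(2)[OF that] by (simp add: y_def)
  \<comment> \<open>Outside \<open>i\<close> the combination has norm at most the sum of the missing masses \<open>1 - N i (y k)\<close>, so in
    the coordinate \<open>i\<close> there is no cancellation.\<close>
  have no_cancel: "(\<Sum>k<n. w k * N i (y k)) \<le> N i (\<Sum>k<n. w k *\<^sub>R y k)"
  proof -
    let ?x = "\<Sum>k<n. w k *\<^sub>R x k"
    have xin: "?x \<in> L" using xL by (auto intro!: l1.sum_mem l1.scale_mem)
    have "N1 (?x(i := 0)) \<le> (\<Sum>k<n. w k * N1 ((x k)(i := 0)))"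
      unfolding rest_sum by (rule l1.norm_sum_scale_le) (use xL w rest_mem in auto)
    also have "\<dots> \<le> (\<Sum>k<n. w k * (1 - N i (y k)))"
    proof (intro sum_mono mult_left_mono)
      fix k assume "k \<in> {..<n}"
      then show "N1 ((x k)(i := 0)) \<le> 1 - N i (y k)" "0 \<le> w k"
        using norm_split[OF xL(1), of k i] xL(2)[of k] w by (auto simp: y_def)
    qed
    also have "\<dots> = 1 - (\<Sum>k<n. w k * N i (y k))" by (simp add: algebra_simps sum_subtractf w)
    finally show ?thesis
      using norm_split[OF xin, of i] x1 by (simp add: y_def sum_apply scaleR_fun_def)
  qed
  \<comment> \<open>Without cancellation the vectors may be rescaled to norm one.\<close>
  define a where "a k = w k / N i (y k)" for k
  define M where "M = (\<Sum>k<n. 1 / N i (y k))"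
  have inv_le: "1 / N i (y k) \<le> M" if "k < n" for k
    unfolding M_def using that ypos by (intro member_le_sum) (auto intro: less_imp_le)
  have "N i (\<Sum>k<n. a k *\<^sub>R y k) = (\<Sum>k<n. a k * N i (y k))"
  proof (rule coord.norm_sum_reweight[OF _ _ no_cancel])
    show "0 \<le> M" unfolding M_def using ypos by (intro sum_nonneg) (auto intro: less_imp_le)
    fix k assume k: "k \<in> {..<n}"
    then show "0 \<le> a k" using w ypos[of k] by (simp add: a_def)
    have "w k * (1 / N i (y k)) \<le> w k * M" using w inv_le[of k] k by (intro mult_left_mono) auto
    then show "a k \<le> M * w k" by (simp add: a_def mult.commute)
  qed (use yX in auto)
  also have "\<dots> = 1" unfolding w(2)[symmetric] by (rule sum.cong) (use ypos in \<open>force simp: a_def\<close>)+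
  finally have N_z: "N i (\<Sum>k<n. a k *\<^sub>R y k) = 1" .
  define z where "z k = (1 / N i (y k)) *\<^sub>R y k" for k
  have z_sum: "(\<Sum>k<n. w k *\<^sub>R z k) = (\<Sum>k<n. a k *\<^sub>R y k)" by (simp add: z_def a_def)
  have zS: "z k \<in> S k" if k: "k < n" for k
  proof -
    have z: "z k \<in> X i" "N i (z k) = 1"
      using ypos[OF k] yX[OF k] by (auto simp: z_def coord.norm_scale coord.scale_mem)
    have "(1 - e k) * N i (y k) \<le> (1 - e k) * 1" using y1[OF k] e(2)[OF k] by (intro mult_left_mono) auto
    also have "\<dots> \<le> f k (y k)" using xL(3)[OF k] by (simp add: y_def)
    finally have "1 - e k \<le> f k (z k)"
      using ypos[OF k] by (simp add: z_def coord.dual_scale[OF fY(2)[OF k] yX[OF k]] field_simps)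
    then show ?thesis using z by (simp add: Sk[OF k] slice_def unit_ball_def)
  qed
  have "(\<Sum>k<n. w k *\<^sub>R z k) \<in> X i"
    by (intro coord.sum_mem coord.scale_mem) (use yX in \<open>auto simp: z_def intro: coord.scale_mem\<close>)
  then have "(\<Sum>k<n. w k *\<^sub>R z k) \<in> unit_sphere (X i) (N i)"
    using N_z by (simp add: unit_sphere_def z_sum)
  then show "{\<Sum>k<n. w k *\<^sub>R s k | s. \<forall>k<n. s k \<in> S k} \<inter> unit_sphere (X i) (N i) \<noteq> {}"
    using zS by blast
qed

end

section \<open>The equivalences\<close>

theorem proposition4p8:
  fixes X :: "'i \<Rightarrow> 'a::real_vector set"
    and N :: "'i \<Rightarrow> 'a \<Rightarrow> real"
    and Y :: "'i \<Rightarrow> ('a \<Rightarrow> real) set"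
    and \<kappa> :: "'k rel"
  assumes "\<And>i. normed_space_on (X i) (N i)"
    and "\<And>i. X i \<noteq> {0}"
    and "\<And>i. Y i \<subseteq> dual_space (X i) (N i)"
    and "\<And>i. subspace (Y i)"
    and "Cinfinite \<kappa>"
  shows "((\<forall>i. SD2P_less \<kappa> (X i) (N i) (Y i)) \<longleftrightarrow>
            SD2P_less \<kappa> (l1_space X N) (l1_norm N) (linf_space X N Y)) \<and>
         ((\<forall>i. one_ASD2P_less \<kappa> (X i) (N i) (Y i)) \<longleftrightarrow>
            one_ASD2P_less \<kappa> (l1_space X N) (l1_norm N) (linf_space X N Y)) \<and>
         ((\<forall>i. ASD2P (X i) (N i) (Y i)) \<longleftrightarrow>
            ASD2P (l1_space X N) (l1_norm N) (linf_space X N Y))"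
proof -
  interpret dual_pair_family X N Y
    by (intro dual_pair_family.intro assms(1-4))
  show ?thesis
    using SD2P_less_sum SD2P_less_coord one_ASD2P_less_sum one_ASD2P_less_coord ASD2P_sum ASD2P_coord
    by blast
qed

end
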